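(* Let $\mathcal A\subseteq\mathbb N$, $L$ an environment and $T$ a term. If $L\vdash_{\mathcal A}T$, then the closure $(L,T)$ is strongly qrst-normalizing.
   Context: Fix a nonempty set $\Sigma$ of sorts with decidable equality, an arbitrary function $\mathrm{next}:\Sigma\to\Sigma$, and a countably infinite set of variables. Terms and environments: $T,U,V,W ::= \star s \mid x \mid \mathrm{app}(V,T) \mid \lambda x{:}W.\,T \mid \mathrm{def}(x{=}V).\,T \mid \mathrm{cast}(U,T)$ ($s\in\Sigma$) and $L,K ::= \emptyset \mid K,x{:}W \mid K,x{=}V$. $\mathrm{app}(V,T)$ applies $T$ to $V$; $\lambda x{:}W.\,T$ (de Bruijn's abstraction) and $\mathrm{def}(x{=}V).\,T$ (local definition) bind $x$ in $T$; $\mathrm{cast}(U,T)$ annotates $T$ with expected type $U$; entries $x{:}W$ and $x{=}V$ bind $x$. Terms are modulo renaming of bound variables, with bound variables distinct from each other and from free ones. Write $\mathsf{B}x[V]$ for either $\lambda x{:}V$ or $\mathrm{def}(x{=}V)$ and correspondingly $L,x[V]$ for $L,x{:}V$ resp. $L,x{=}V$ (same kind within a rule). A closure is a pair $(L,T)$. Bound rt-reduction $L\vdash T_1\to^nT_2$ is the smallest relation closed under: $L\vdash\mathrm{app}(V,\lambda x{:}W.\,T)\to^0\mathrm{def}(x{=}\mathrm{cast}(W,V)).\,T$; $K,x{=}V\vdash x\to^0V$; $L\vdash\mathrm{def}(x{=}V).\,T\to^0T$ if $x$ not free in $T$; $L\vdash\mathrm{app}(V,\mathrm{def}(x{=}W).\,T)\to^0\mathrm{def}(x{=}W).\,\mathrm{app}(V,T)$;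 $L\vdash\mathrm{cast}(U,T)\to^0T$; $L\vdash\star s\to^1\star\,\mathrm{next}(s)$; $K,x{:}W\vdash x\to^1W$; $L\vdash\mathrm{cast}(U,T)\to^1U$; if $K\vdash x\to^nT$, $y\neq x$, $y$ not free in $T$ then $K,y[V]\vdash x\to^nT$; if $L\vdash V_1\to^0V_2$ then $L\vdash\mathrm{app}(V_1,T)\to^0\mathrm{app}(V_2,T)$; if $L\vdash T_1\to^nT_2$ then $L\vdash\mathrm{app}(V,T_1)\to^n\mathrm{app}(V,T_2)$; if $L\vdash V_1\to^0V_2$ then $L\vdash\mathsf Bx[V_1].\,T\to^0\mathsf Bx[V_2].\,T$; if $L,x[V]\vdash T_1\to^nT_2$ then $L\vdash\mathsf Bx[V].\,T_1\to^n\mathsf Bx[V].\,T_2$; if $L\vdash U_1\to^0U_2$ then $L\vdash\mathrm{cast}(U_1,T)\to^0\mathrm{cast}(U_2,T)$; if $L\vdash T_1\to^0T_2$ then $L\vdash\mathrm{cast}(U,T_1)\to^0\mathrm{cast}(U,T_2)$; if $L\vdash U_1\to^1U_2$ and $L\vdash T_1\to^1T_2$ then $L\vdash\mathrm{cast}(U_1,T_1)\to^1\mathrm{cast}(U_2,T_2)$. $L\vdash T_1\to^{*n}T_2$ is the smallest relation with $L\vdash T\to^{*0}T$, containing single steps, and with $L\vdash T_1\to^{*n_1}T$, $L\vdash T\to^{*n_2}T_2$ implying $L\vdash T_1\to^{*n_1+n_2}T_2$. Validity $L\vdash_{\mathcal A}T$ is the smallest predicate closed under: $L\vdash_{\mathcal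 A}\star s$; if $K\vdash_{\mathcal A}V$ then $K,x[V]\vdash_{\mathcal A}x$; if $K\vdash_{\mathcal A}x$ and $y\neq x$ then $K,y[V]\vdash_{\mathcal A}x$; if $L\vdash_{\mathcal A}V$ and $L,x[V]\vdash_{\mathcal A}T$ then $L\vdash_{\mathcal A}\mathsf Bx[V].\,T$; if $L\vdash_{\mathcal A}U$, $L\vdash_{\mathcal A}T$ and some $U_0$ satisfies $L\vdash T\to^{*1}U_0$, $L\vdash U\to^{*0}U_0$, then $L\vdash_{\mathcal A}\mathrm{cast}(U,T)$; if $L\vdash_{\mathcal A}V$, $L\vdash_{\mathcal A}T$ and there are $n\in\mathcal A$, $x,W_0,U_0$ with $L\vdash T\to^{*n}\lambda x{:}W_0.\,U_0$ and $L\vdash V\to^{*1}W_0$, then $L\vdash_{\mathcal A}\mathrm{app}(V,T)$. Extended rt-reduction $L\vdash T_1\leadsto T_2$ is the smallest relation closed under: $L\vdash\mathrm{app}(V,\lambda x{:}W.\,T)\leadsto\mathrm{def}(x{=}\mathrm{cast}(W,V)).\,T$; $L\vdash\mathrm{app}(V,\mathrm{def}(x{=}W).\,T)\leadsto\mathrm{def}(x{=}W).\,\mathrm{app}(V,T)$; $K,x[V]\vdash x\leadsto V$; $L\vdash\mathrm{def}(x{=}V).\,T\leadsto T$ if $x$ not free in $T$; $L\vdash\mathrm{cast}(U,T)\leadsto T$; $L\vdash\star s_1\leadsto\star s_2$ for any $s_1,s_2\in\Sigma$; $L\vdash\mathrm{cast}(U,T)\leadsto U$; if $K\vdash x\leadsto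 T$, $y\neq x$, $y$ not free in $T$ then $K,y[V]\vdash x\leadsto T$; if $L\vdash V_1\leadsto V_2$ then $L\vdash\mathrm{app}(V_1,T)\leadsto\mathrm{app}(V_2,T)$, $L\vdash\mathsf Bx[V_1].\,T\leadsto\mathsf Bx[V_2].\,T$ and $L\vdash\mathrm{cast}(V_1,T)\leadsto\mathrm{cast}(V_2,T)$; if $L\vdash T_1\leadsto T_2$ then $L\vdash\mathrm{app}(V,T_1)\leadsto\mathrm{app}(V,T_2)$ and $L\vdash\mathrm{cast}(U,T_1)\leadsto\mathrm{cast}(U,T_2)$; if $L,x[V]\vdash T_1\leadsto T_2$ then $L\vdash\mathsf Bx[V].\,T_1\leadsto\mathsf Bx[V].\,T_2$. On environments, $L_1\leadsto L_2$ is the smallest relation such that $K_1\leadsto K_2$ implies $K_1,y[V]\leadsto K_2,y[V]$, and $K\vdash V_1\leadsto V_2$ implies $K,y[V_1]\leadsto K,y[V_2]$. Direct subclosure $(L_1,T_1)\sqsupset(L_2,T_2)$ holds in exactly these cases: $(K,x[V],x)\sqsupset(K,V)$; $(K,y[V],T)\sqsupset(K,T)$ if $y$ is not free in $T$; $(L,\mathrm{app}(V,T))\sqsupset(L,V)$ and $\sqsupset(L,T)$; $(L,\mathrm{cast}(V,T))\sqsupset(L,V)$ and $\sqsupset(L,T)$; $(L,\mathsf Bx[V].\,T)\sqsupset(L,V)$ and $\sqsupset(L,x[V],T)$. Inherited free variables $F(L,T)$: $F(L,\star s)=\emptyset$; $F(K,x[V],x)=F(K,V)\cup\{x\}$; $F(\emptyset,x)=\{x\}$;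 $F(K,y[V],x)=F(K,x)$ for $y\ne x$; $F(L,\mathsf Bx[V].\,T)=F(L,V)\cup(F(L,x[V],T)\setminus\{x\})$; $F(L,\mathrm{app}(V,T))=F(L,\mathrm{cast}(V,T))=F(L,V)\cup F(L,T)$. For a finite set $f$ of variables, $L_1=_fL_2$ is the smallest relation with: $\emptyset=_f\emptyset$; if $K_1=_fK_2$ and $y\notin f$ then $K_1,y[V_1]=_fK_2,y[V_2]$; if $K_1=_fK_2$, $y\notin f$ and $V_1=V_2$ then $K_1,y[V_1]=_{f\cup\{y\}}K_2,y[V_2]$ (entries of the same kind). $L_1=_TL_2$ means $L_1=_{F(L_1,T)}L_2$. Sort irrelevance on terms $T_1\approx T_2$: $\star s_1\approx\star s_2$ for all sorts; $x\approx x$; $\mathsf Bx[V_1].\,T_1\approx\mathsf Bx[V_2].\,T_2$, $\mathrm{app}(V_1,T_1)\approx\mathrm{app}(V_2,T_2)$, $\mathrm{cast}(V_1,T_1)\approx\mathrm{cast}(V_2,T_2)$ whenever $V_1\approx V_2$ and $T_1\approx T_2$. On environments $L_1\approx_fL_2$ is defined like $=_f$ but with $V_1\approx V_2$ in place of $V_1=V_2$. On closures $(L_1,T_1)\approx(L_2,T_2)$ iff $L_1\approx_{F(L_1,T_1)}L_2$ and $T_1\approx T_2$. One qrst-step $(L_1,T_1)\succ(L_2,T_2)$ holds if: $L_1=L_2$ and $L_1\vdash T_1\leadsto T_2$; or $T_1=T_2$ and $L_1\leadsto L_2$; or $T_1=T_2$ and $L_1=_{T_1}L_2$; or $(L_1,T_1)\sqsupset(L_2,T_2)$.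 Strong qrst-normalization is the smallest predicate $\mathrm{SN}$ on closures such that $\mathrm{SN}(L_1,T_1)$ holds whenever $\mathrm{SN}(L_2,T_2)$ holds for all $(L_2,T_2)$ with $(L_1,T_1)\succ(L_2,T_2)$ and $(L_1,T_1)\not\approx(L_2,T_2)$. *)

theory Defs
  imports Main
begin

text \<open>
  Terms modulo renaming of bound variables are represented by de Bruijn indices, and the
  environments of closures likewise: an environment is a list whose head is its most recent
  (rightmost) entry, \<open>Var i\<close> refers to the entry at position \<open>i\<close>, and indices
  beyond the length of the environment are the variables it does not bind.  The two kinds of
  binder share the constructor \<open>Bind\<close> and the entry form \<open>(b, V)\<close>:
  \<open>Abst\<close> stands for \<open>\<lambda>x:V\<close> and \<open>x:V\<close>, \<open>Abbr\<close> for
  \<open>def(x=V)\<close> and \<open>x=V\<close>.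
\<close>

datatype bkind = Abst | Abbr

datatype 's trm =
    Sort 's
  | Var nat
  | App "'s trm" "'s trm"
  | Bind bkind "'s trm" "'s trm"
  | Cast "'s trm" "'s trm"

abbreviation Lam :: "'s trm \<Rightarrow> 's trm \<Rightarrow> 's trm" where
  "Lam W T \<equiv> Bind Abst W T"

abbreviation Def :: "'s trm \<Rightarrow> 's trm \<Rightarrow> 's trm" where
  "Def V T \<equiv> Bind Abbr V T"

type_synonym 's env = "(bkind \<times> 's trm) list"
type_synonym 's closure = "'s env \<times> 's trm"

text \<open>
  \<open>lift 0 T\<close> is the term \<open>T\<close> seen under one more binder \<open>y\<close>.  The terms of the
  form \<open>lift 0 T\<close> are exactly those in which the innermost variable is not free; this is how
  side conditions ``\<open>y\<close> is not free in \<open>T\<close>'', and implicit ones due to the variable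
  convention, are expressed below.
\<close>

primrec lift :: "nat \<Rightarrow> 's trm \<Rightarrow> 's trm" where
  "lift d (Sort s) = Sort s"
| "lift d (Var i) = Var (if i < d then i else Suc i)"
| "lift d (App V T) = App (lift d V) (lift d T)"
| "lift d (Bind b V T) = Bind b (lift d V) (lift (Suc d) T)"
| "lift d (Cast U T) = Cast (lift d U) (lift d T)"


inductive rt_step :: "('s \<Rightarrow> 's) \<Rightarrow> 's env \<Rightarrow> nat \<Rightarrow> 's trm \<Rightarrow> 's trm \<Rightarrow> bool"
  for nxt :: "'s \<Rightarrow> 's"
where
  rt_beta: "rt_step nxt L 0 (App V (Lam W T)) (Def (Cast W V) T)"
| rt_delta: "rt_step nxt ((Abbr, V) # K) 0 (Var 0) (lift 0 V)"
| rt_zeta: "rt_step nxt L 0 (Def V (lift 0 T)) T"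
| rt_theta: "rt_step nxt L 0 (App V (Def W T)) (Def W (App (lift 0 V) T))"
| rt_eps: "rt_step nxt L 0 (Cast U T) T"
| rt_sort: "rt_step nxt L 1 (Sort s) (Sort (nxt s))"
| rt_decl: "rt_step nxt ((Abst, W) # K) 1 (Var 0) (lift 0 W)"
| rt_ee: "rt_step nxt L 1 (Cast U T) U"
| rt_lref: "rt_step nxt K n (Var i) T \<Longrightarrow>
    rt_step nxt ((b, V) # K) n (Var (Suc i)) (lift 0 T)"
| rt_app1: "rt_step nxt L 0 V1 V2 \<Longrightarrow> rt_step nxt L 0 (App V1 T) (App V2 T)"
| rt_app2: "rt_step nxt L n T1 T2 \<Longrightarrow> rt_step nxt L n (App V T1) (App V T2)"
| rt_bind1: "rt_step nxt L 0 V1 V2 \<Longrightarrow> rt_step nxt L 0 (Bind b V1 T) (Bind b V2 T)"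
| rt_bind2: "rt_step nxt ((b, V) # L) n T1 T2 \<Longrightarrow>
    rt_step nxt L n (Bind b V T1) (Bind b V T2)"
| rt_cast1: "rt_step nxt L 0 U1 U2 \<Longrightarrow> rt_step nxt L 0 (Cast U1 T) (Cast U2 T)"
| rt_cast2: "rt_step nxt L 0 T1 T2 \<Longrightarrow> rt_step nxt L 0 (Cast U T1) (Cast U T2)"
| rt_cast: "rt_step nxt L 1 U1 U2 \<Longrightarrow> rt_step nxt L 1 T1 T2 \<Longrightarrow>
    rt_step nxt L 1 (Cast U1 T1) (Cast U2 T2)"

inductive rt_steps :: "('s \<Rightarrow> 's) \<Rightarrow> 's env \<Rightarrow> nat \<Rightarrow> 's trm \<Rightarrow> 's trm \<Rightarrow> bool"
  for nxt :: "'s \<Rightarrow> 's" and L :: "'s env"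
where
  rts_refl: "rt_steps nxt L 0 T T"
| rts_step: "rt_step nxt L n T1 T2 \<Longrightarrow> rt_steps nxt L n T1 T2"
| rts_trans: "rt_steps nxt L n1 T1 T \<Longrightarrow> rt_steps nxt L n2 T T2 \<Longrightarrow>
    rt_steps nxt L (n1 + n2) T1 T2"


inductive valid :: "('s \<Rightarrow> 's) \<Rightarrow> nat set \<Rightarrow> 's env \<Rightarrow> 's trm \<Rightarrow> bool"
  for nxt :: "'s \<Rightarrow> 's" and A :: "nat set"
where
  valid_sort: "valid nxt A L (Sort s)"
| valid_var0: "valid nxt A K V \<Longrightarrow> valid nxt A ((b, V) # K) (Var 0)"
| valid_lref: "valid nxt A K (Var i) \<Longrightarrow> valid nxt A ((b, V) # K) (Var (Suc i))"
| valid_bind: "valid nxt A L V \<Longrightarrow> valid nxt A ((b, V) # L) T \<Longrightarrow> valid nxt A L (Bind b V T)"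
| valid_cast: "valid nxt A L U \<Longrightarrow> valid nxt A L T \<Longrightarrow>
    rt_steps nxt L 1 T U0 \<Longrightarrow> rt_steps nxt L 0 U U0 \<Longrightarrow> valid nxt A L (Cast U T)"
| valid_app: "valid nxt A L V \<Longrightarrow> valid nxt A L T \<Longrightarrow> n \<in> A \<Longrightarrow>
    rt_steps nxt L n T (Lam W0 U0) \<Longrightarrow> rt_steps nxt L 1 V W0 \<Longrightarrow> valid nxt A L (App V T)"


inductive ext_step :: "'s env \<Rightarrow> 's trm \<Rightarrow> 's trm \<Rightarrow> bool" where
  ext_beta: "ext_step L (App V (Lam W T)) (Def (Cast W V) T)"
| ext_theta: "ext_step L (App V (Def W T)) (Def W (App (lift 0 V) T))"
| ext_var0: "ext_step ((b, V) # K) (Var 0) (lift 0 V)"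
| ext_zeta: "ext_step L (Def V (lift 0 T)) T"
| ext_eps: "ext_step L (Cast U T) T"
| ext_sort: "ext_step L (Sort s1) (Sort s2)"
| ext_ee: "ext_step L (Cast U T) U"
| ext_lref: "ext_step K (Var i) T \<Longrightarrow> ext_step ((b, V) # K) (Var (Suc i)) (lift 0 T)"
| ext_app1: "ext_step L V1 V2 \<Longrightarrow> ext_step L (App V1 T) (App V2 T)"
| ext_bind1: "ext_step L V1 V2 \<Longrightarrow> ext_step L (Bind b V1 T) (Bind b V2 T)"
| ext_cast1: "ext_step L V1 V2 \<Longrightarrow> ext_step L (Cast V1 T) (Cast V2 T)"
| ext_app2: "ext_step L T1 T2 \<Longrightarrow> ext_step L (App V T1) (App V T2)"
| ext_cast2: "ext_step L T1 T2 \<Longrightarrow> ext_step L (Cast U T1) (Cast U T2)"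
| ext_bind2: "ext_step ((b, V) # L) T1 T2 \<Longrightarrow> ext_step L (Bind b V T1) (Bind b V T2)"

inductive ext_env_step :: "'s env \<Rightarrow> 's env \<Rightarrow> bool" where
  ext_env_tail: "ext_env_step K1 K2 \<Longrightarrow> ext_env_step ((b, V) # K1) ((b, V) # K2)"
| ext_env_head: "ext_step K V1 V2 \<Longrightarrow> ext_env_step ((b, V1) # K) ((b, V2) # K)"


inductive dsub :: "'s closure \<Rightarrow> 's closure \<Rightarrow> bool" where
  dsub_var0: "dsub ((b, V) # K, Var 0) (K, V)"
| dsub_drop: "dsub ((b, V) # K, lift 0 T) (K, T)"
| dsub_app1: "dsub (L, App V T) (L, V)"
| dsub_app2: "dsub (L, App V T) (L, T)"
| dsub_cast1: "dsub (L, Cast V T) (L, V)"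
| dsub_cast2: "dsub (L, Cast V T) (L, T)"
| dsub_bind1: "dsub (L, Bind b V T) (L, V)"
| dsub_bind2: "dsub (L, Bind b V T) ((b, V) # L, T)"


primrec weight :: "'s trm \<Rightarrow> nat" where
  "weight (Sort s) = 1"
| "weight (Var i) = 1"
| "weight (App V T) = Suc (weight V + weight T)"
| "weight (Bind b V T) = Suc (weight V + weight T)"
| "weight (Cast U T) = Suc (weight U + weight T)"

lemma weight_pos [simp]: "0 < weight T"
  by (cases T) simp_all

text \<open>
  A set \<open>f\<close> of variables of \<open>K\<close> becomes \<open>Suc ` f\<close> in an extension of \<open>K\<close> by one
  entry, whose own variable is \<open>0\<close>; \<open>{i. Suc i \<in> g}\<close> removes that variable from \<open>g\<close> and
  reindexes the others.
\<close>

function fvs :: "'s env \<Rightarrow> 's trm \<Rightarrow> nat set" where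
  "fvs L (Sort s) = {}"
| "fvs [] (Var i) = {i}"
| "fvs ((b, V) # K) (Var 0) = insert 0 (Suc ` fvs K V)"
| "fvs ((b, V) # K) (Var (Suc i)) = Suc ` fvs K (Var i)"
| "fvs L (Bind b V T) = fvs L V \<union> {i. Suc i \<in> fvs ((b, V) # L) T}"
| "fvs L (App V T) = fvs L V \<union> fvs L T"
| "fvs L (Cast U T) = fvs L U \<union> fvs L T"
  by pat_completeness auto
termination
  by (relation "measure (\<lambda>(L, T). sum_list (map (weight \<circ> snd) L) + weight T)") auto

lemma finite_fvs: "finite (fvs L T)"
proof (induction L T rule: fvs.induct)
  case (5 L b V T)
  then show ?case
    using finite_vimageI[of "fvs ((b, V) # L) T" Suc] by (simp add: vimage_def)
qed auto


text \<open>
  Environments that agree up to \<open>R\<close> on the entries selected by \<open>f\<close>, the others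
  being constrained only in kind.  All sets \<open>f\<close> used below are finite by
  \<open>finite_fvs\<close>.
\<close>

inductive env_rel :: "('s trm \<Rightarrow> 's trm \<Rightarrow> bool) \<Rightarrow> nat set \<Rightarrow> 's env \<Rightarrow> 's env \<Rightarrow> bool"
  for R :: "'s trm \<Rightarrow> 's trm \<Rightarrow> bool"
where
  env_rel_nil: "finite f \<Longrightarrow> env_rel R f [] []"
| env_rel_skip: "env_rel R f K1 K2 \<Longrightarrow> env_rel R (Suc ` f) ((b, V1) # K1) ((b, V2) # K2)"
| env_rel_keep: "env_rel R f K1 K2 \<Longrightarrow> R V1 V2 \<Longrightarrow>
    env_rel R (insert 0 (Suc ` f)) ((b, V1) # K1) ((b, V2) # K2)"

definition env_eq :: "'s trm \<Rightarrow> 's env \<Rightarrow> 's env \<Rightarrow> bool" where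
  "env_eq T L1 L2 \<longleftrightarrow> env_rel (=) (fvs L1 T) L1 L2"

inductive sirr :: "'s trm \<Rightarrow> 's trm \<Rightarrow> bool" where
  sirr_sort: "sirr (Sort s1) (Sort s2)"
| sirr_var: "sirr (Var i) (Var i)"
| sirr_bind: "sirr V1 V2 \<Longrightarrow> sirr T1 T2 \<Longrightarrow> sirr (Bind b V1 T1) (Bind b V2 T2)"
| sirr_app: "sirr V1 V2 \<Longrightarrow> sirr T1 T2 \<Longrightarrow> sirr (App V1 T1) (App V2 T2)"
| sirr_cast: "sirr V1 V2 \<Longrightarrow> sirr T1 T2 \<Longrightarrow> sirr (Cast V1 T1) (Cast V2 T2)"

fun sirr_closure :: "'s closure \<Rightarrow> 's closure \<Rightarrow> bool" where
  "sirr_closure (L1, T1) (L2, T2) \<longleftrightarrow> env_rel sirr (fvs L1 T1) L1 L2 \<and> sirr T1 T2"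


inductive qrst_step :: "'s closure \<Rightarrow> 's closure \<Rightarrow> bool" where
  qrst_term: "ext_step L T1 T2 \<Longrightarrow> qrst_step (L, T1) (L, T2)"
| qrst_env: "ext_env_step L1 L2 \<Longrightarrow> qrst_step (L1, T) (L2, T)"
| qrst_eq: "env_eq T L1 L2 \<Longrightarrow> qrst_step (L1, T) (L2, T)"
| qrst_sub: "dsub C1 C2 \<Longrightarrow> qrst_step C1 C2"

inductive SN :: "'s closure \<Rightarrow> bool" where
  SN_intro: "(\<And>C2. qrst_step C1 C2 \<Longrightarrow> \<not> sirr_closure C1 C2 \<Longrightarrow> SN C2) \<Longrightarrow> SN C1"

end

theory Submission imports Defs begin

text \<open>
  Valid terms have an arity, a simple type in which an abstraction over \<open>W\<close> is a function on
  the arity of \<open>W\<close>, and all the steps preserve having one.  In the manner of Gandy and van de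
  Pol, a term of arity \<open>a\<close> is interpreted by a hereditarily monotone functional over the natural
  numbers; every element, functional or not, also carries a number, its \<open>star\<close>, and the value
  of a variable declared or defined by \<open>V\<close> lies strictly above the value of \<open>V\<close>.  Every step
  that is not a sort irrelevance then decreases the number carried by the value of the closure,
  except for the removal of an unused environment entry, which preserves it and shortens the
  environment.

  HOL has no type containing the full hierarchy of functionals over all arities.  The functionals
  are therefore taken from a graph model, where an element is a set of tokens and \<open>TArr xs t\<close>
  records that arguments containing \<open>xs\<close> give a result containing \<open>t\<close>.
\<close>

section \<open>A graph model with a size attached to every element\<close>

datatype tok = TNum nat | TArr "tok list" tok

type_synonym elt = "tok set"

definition fapp :: "elt \<Rightarrow> elt \<Rightarrow> elt" where
  "fapp U X = {t. \<exists>xs. set xs \<subseteq> X \<and> TArr xs t \<in> U}"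

text \<open>The graph of \<open>f\<close>, together with the number tokens of \<open>Q\<close>. The
  number carried by a function is thus chosen separately from its behaviour on arguments.\<close>

definition flam :: "elt \<Rightarrow> (elt \<Rightarrow> elt) \<Rightarrow> elt" where
  "flam Q f = {t. case t of TNum n \<Rightarrow> TNum n \<in> Q | TArr xs u \<Rightarrow> u \<in> f (set xs)}"

primrec res :: "tok \<Rightarrow> nat" where
  "res (TNum n) = n"
| "res (TArr xs t) = res t"

text \<open>A single element serves as the constant functional \<open>n\<close> at every arity,
  because applying it to anything gives it back (\<open>fapp_cst\<close>). No arity has to be
  supplied.\<close>

definition cst :: "nat \<Rightarrow> elt" where
  "cst n = {t. res t = n}"

text \<open>On sized elements this is \<open>cst (star U)\<close>. Phrasing it by membership instead
  of through \<open>THE\<close> makes it continuous in \<open>U\<close> on all token sets.\<close>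

definition cst_star :: "elt \<Rightarrow> elt" where
  "cst_star U = {t. TNum (res t) \<in> U}"

text \<open>Pointwise addition of functionals. The recursion is on the token being tested, since an
  element does not carry an arity to recurse on.\<close>

primrec in_plus :: "tok \<Rightarrow> elt \<Rightarrow> elt \<Rightarrow> bool" where
  "in_plus (TNum k) U V \<longleftrightarrow> (\<exists>m n. k = m + n \<and> TNum m \<in> U \<and> TNum n \<in> V)"
| "in_plus (TArr xs t) U V \<longleftrightarrow> in_plus t (fapp U (set xs)) (fapp V (set xs))"

definition eplus :: "elt \<Rightarrow> elt \<Rightarrow> elt" (infixl "\<oplus>" 65) where
  "U \<oplus> V = {t. in_plus t U V}"

text \<open>Scott continuity on the powerset of tokens: monotonicity and dependence on finite
  subsets in one equivalence. It is what makes the beta law \<open>fapp_flam\<close> hold.\<close>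

definition cont :: "(elt \<Rightarrow> elt) \<Rightarrow> bool" where
  "cont f \<longleftrightarrow> (\<forall>X t. t \<in> f X \<longleftrightarrow> (\<exists>F. finite F \<and> F \<subseteq> X \<and> t \<in> f F))"

section \<open>Continuous operators on token sets\<close>

lemma contI:
  assumes "\<And>X Y t. X \<subseteq> Y \<Longrightarrow> t \<in> f X \<Longrightarrow> t \<in> f Y"
    and "\<And>X t. t \<in> f X \<Longrightarrow> \<exists>F. finite F \<and> F \<subseteq> X \<and> t \<in> f F"
  shows "cont f"
  unfolding cont_def using assms by meson

lemma cont_mono: "cont f \<Longrightarrow> X \<subseteq> Y \<Longrightarrow> t \<in> f X \<Longrightarrow> t \<in> f Y"
  unfolding cont_def by (meson order_trans)

lemma cont_fin: "cont f \<Longrightarrow> t \<in> f X \<Longrightarrow> \<exists>F. finite F \<and> F \<subseteq> X \<and> t \<in> f F"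
  unfolding cont_def by blast

lemma cont_fin_subset:
  assumes "cont f" "finite A" "A \<subseteq> f X"
  shows "\<exists>F. finite F \<and> F \<subseteq> X \<and> A \<subseteq> f F"
  using assms(2,3)
proof (induction A rule: finite_induct)
  case empty
  then show ?case by blast
next
  case (insert a A)
  then obtain F G where "finite F" "F \<subseteq> X" "A \<subseteq> f F" "finite G" "G \<subseteq> X" "a \<in> f G"
    using cont_fin[OF assms(1), of a X] by auto
  moreover have "f F \<subseteq> f (F \<union> G)" "f G \<subseteq> f (F \<union> G)"
    using cont_mono[OF assms(1)] by (meson Un_upper1 Un_upper2 subsetI)+
  ultimately show ?case
    by (intro exI[of _ "F \<union> G"]) auto
qed

lemma cont_const: "cont (\<lambda>X. U)"
  by (rule contI) auto

lemma cont_id: "cont (\<lambda>X. X)"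
proof (rule contI)
  show "\<exists>F. finite F \<and> F \<subseteq> X \<and> t \<in> F" if "t \<in> X" for X :: elt and t
    using that by (intro exI[of _ "{t}"]) auto
qed auto

lemma cont_fapp:
  assumes "cont f" "cont g"
  shows "cont (\<lambda>X. fapp (f X) (g X))"
proof (rule contI)
  fix X Y t assume XY: "X \<subseteq> Y" and "t \<in> fapp (f X) (g X)"
  then obtain xs where "set xs \<subseteq> g X" "TArr xs t \<in> f X"
    unfolding fapp_def by blast
  then have "set xs \<subseteq> g Y" "TArr xs t \<in> f Y"
    using cont_mono[OF assms(1) XY] cont_mono[OF assms(2) XY] by auto
  then show "t \<in> fapp (f Y) (g Y)"
    unfolding fapp_def by blast
next
  fix X t assume "t \<in> fapp (f X) (g X)"
  then obtain xs where xs: "set xs \<subseteq> g X" "TArr xs t \<in> f X"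
    unfolding fapp_def by blast
  obtain F where F: "finite F" "F \<subseteq> X" "set xs \<subseteq> g F"
    using cont_fin_subset[OF assms(2) _ xs(1)] by auto
  obtain G where G: "finite G" "G \<subseteq> X" "TArr xs t \<in> f G"
    using cont_fin[OF assms(1) xs(2)] by auto
  have "set xs \<subseteq> g (F \<union> G)" "TArr xs t \<in> f (F \<union> G)"
    using F(3) G(3) cont_mono[OF assms(1), of G "F \<union> G"] cont_mono[OF assms(2), of F "F \<union> G"]
    by auto
  then show "\<exists>F. finite F \<and> F \<subseteq> X \<and> t \<in> fapp (f F) (g F)"
    using F G unfolding fapp_def by (intro exI[of _ "F \<union> G"]) auto
qed

lemma TNum_eplus: "TNum k \<in> U \<oplus> V \<longleftrightarrow> (\<exists>m n. k = m + n \<and> TNum m \<in> U \<and> TNum n \<in> V)"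
  by (simp add: eplus_def)

lemma TArr_eplus: "TArr xs t \<in> U \<oplus> V \<longleftrightarrow> t \<in> fapp U (set xs) \<oplus> fapp V (set xs)"
  by (simp add: eplus_def)

lemma cont_eplus:
  assumes "cont f" "cont g"
  shows "cont (\<lambda>X. f X \<oplus> g X)"
proof -
  have "t \<in> f X \<oplus> g X \<longleftrightarrow> (\<exists>F. finite F \<and> F \<subseteq> X \<and> t \<in> f F \<oplus> g F)" for X t
    using assms
  proof (induction t arbitrary: f g)
    case (TNum k)
    show ?case
    proof
      assume "TNum k \<in> f X \<oplus> g X"
      then obtain m n where mn: "k = m + n" "TNum m \<in> f X" "TNum n \<in> g X"
        by (auto simp: TNum_eplus)
      obtain F where F: "finite F" "F \<subseteq> X" "TNum m \<in> f F"
        using cont_fin[OF TNum(1) mn(2)] by metis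
      obtain G where G: "finite G" "G \<subseteq> X" "TNum n \<in> g G"
        using cont_fin[OF TNum(2) mn(3)] by metis
      have "TNum m \<in> f (F \<union> G)" "TNum n \<in> g (F \<union> G)"
        using cont_mono[OF TNum(1) Un_upper1 F(3)] cont_mono[OF TNum(2) Un_upper2 G(3)] .
      then have "TNum k \<in> f (F \<union> G) \<oplus> g (F \<union> G)"
        using mn(1) unfolding TNum_eplus by blast
      then show "\<exists>F. finite F \<and> F \<subseteq> X \<and> TNum k \<in> f F \<oplus> g F"
        using F(1,2) G(1,2) by (intro exI[of _ "F \<union> G"]) simp
    next
      assume "\<exists>F. finite F \<and> F \<subseteq> X \<and> TNum k \<in> f F \<oplus> g F"
      then obtain F m n where F: "F \<subseteq> X" and mn: "k = m + n" "TNum m \<in> f F" "TNum n \<in> g F"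
        by (auto simp: TNum_eplus)
      have "TNum m \<in> f X" "TNum n \<in> g X"
        using cont_mono[OF TNum(1) F mn(2)] cont_mono[OF TNum(2) F mn(3)] .
      then show "TNum k \<in> f X \<oplus> g X"
        using mn(1) unfolding TNum_eplus by blast
    qed
  next
    case (TArr xs t)
    show ?case
      using TArr.IH(2)[of "\<lambda>X. fapp (f X) (set xs)" "\<lambda>X. fapp (g X) (set xs)",
          OF cont_fapp[OF TArr.prems(1) cont_const] cont_fapp[OF TArr.prems(2) cont_const]]
      unfolding TArr_eplus .
  qed
  then show ?thesis unfolding cont_def by (intro allI)
qed

lemma cont_cst_star: "cont f \<Longrightarrow> cont (\<lambda>X. cst_star (f X))"
  unfolding cst_star_def cont_def by blast

text \<open>The list inside a token fixes the argument of \<open>f X\<close>, so continuity in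
  \<open>X\<close> at each fixed argument suffices.\<close>

lemma cont_flam:
  assumes "cont q" "\<And>Y. cont (\<lambda>X. f X Y)"
  shows "cont (\<lambda>X. flam (q X) (f X))"
  unfolding cont_def
proof (intro allI)
  fix X t
  show "t \<in> flam (q X) (f X) \<longleftrightarrow> (\<exists>F. finite F \<and> F \<subseteq> X \<and> t \<in> flam (q F) (f F))"
  proof (cases t)
    case (TNum n)
    have "TNum n \<in> q X \<longleftrightarrow> (\<exists>F. finite F \<and> F \<subseteq> X \<and> TNum n \<in> q F)"
      using assms(1) unfolding cont_def by (elim allE)
    then show ?thesis by (simp add: TNum flam_def)
  next
    case (TArr xs u)
    have "u \<in> f X (set xs) \<longleftrightarrow> (\<exists>F. finite F \<and> F \<subseteq> X \<and> u \<in> f F (set xs))"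
      using assms(2)[of "set xs"] unfolding cont_def by (elim allE)
    then show ?thesis by (simp add: TArr flam_def)
  qed
qed

lemma fapp_cont_eq:
  assumes "cont f"
  shows "{t. \<exists>xs. set xs \<subseteq> X \<and> t \<in> f (set xs)} = f X"
proof -
  have "t \<in> f X \<longleftrightarrow> (\<exists>xs. set xs \<subseteq> X \<and> t \<in> f (set xs))" for t
    using assms unfolding cont_def by (metis finite_list List.finite_set)
  then show ?thesis by blast
qed

lemma fapp_flam: "cont f \<Longrightarrow> fapp (flam Q f) X = f X"
  using fapp_cont_eq[of f X] by (simp add: fapp_def flam_def)

text \<open>Tokens give the equation at finite arguments; continuity of the right-hand side extends
  it to every \<open>X\<close>.\<close>

lemma fapp_eplus: "fapp (U \<oplus> V) X = fapp U X \<oplus> fapp V X"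
proof -
  have "cont (\<lambda>X. fapp U X \<oplus> fapp V X)"
    by (intro cont_eplus cont_fapp cont_const cont_id)
  from fapp_cont_eq[OF this, of X] show ?thesis
    unfolding fapp_def[of "U \<oplus> V"] TArr_eplus .
qed

lemma fapp_cst: "fapp (cst n) X = cst n"
  unfolding fapp_def cst_def by (auto intro: exI[of _ "[]"])

lemma eplus_assoc: "U \<oplus> V \<oplus> W = U \<oplus> (V \<oplus> W)"
proof -
  have "t \<in> U \<oplus> V \<oplus> W \<longleftrightarrow> t \<in> U \<oplus> (V \<oplus> W)" for t
  proof (induction t arbitrary: U V W)
    case (TNum k)
    have "TNum k \<in> U \<oplus> V \<oplus> W \<longleftrightarrow>
        (\<exists>a b c. k = a + b + c \<and> TNum a \<in> U \<and> TNum b \<in> V \<and> TNum c \<in> W)"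
      unfolding TNum_eplus by blast
    moreover have "TNum k \<in> U \<oplus> (V \<oplus> W) \<longleftrightarrow>
        (\<exists>a b c. k = a + b + c \<and> TNum a \<in> U \<and> TNum b \<in> V \<and> TNum c \<in> W)"
      unfolding TNum_eplus add.assoc by blast
    ultimately show ?case by simp
  next
    case (TArr xs t)
    then show ?case by (simp add: TArr_eplus fapp_eplus)
  qed
  then show ?thesis by blast
qed

lemma cst_eplus_cst: "cst m \<oplus> cst n = cst (m + n)"
proof -
  have "t \<in> cst m \<oplus> cst n \<longleftrightarrow> t \<in> cst (m + n)" for t
    by (induction t) (simp_all add: TNum_eplus TArr_eplus fapp_cst, auto simp: cst_def)
  then show ?thesis by blast
qed

text \<open>\<open>star U\<close> is meaningful only if \<open>sized U\<close> holds.\<close>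

definition sized :: "elt \<Rightarrow> bool" where
  "sized U \<longleftrightarrow> (\<exists>!n. TNum n \<in> U)"

definition star :: "elt \<Rightarrow> nat" where
  "star U = (THE n. TNum n \<in> U)"

lemma star_eqI: "(\<And>m. TNum m \<in> U \<longleftrightarrow> m = n) \<Longrightarrow> sized U \<and> star U = n"
  unfolding sized_def star_def by auto

lemma sized_star: "sized U \<Longrightarrow> TNum m \<in> U \<longleftrightarrow> m = star U"
  unfolding sized_def star_def by (metis theI)

lemma sized_eplus:
  assumes "sized U" "sized V"
  shows "sized (U \<oplus> V) \<and> star (U \<oplus> V) = star U + star V"
  by (rule star_eqI) (simp add: TNum_eplus sized_star[OF assms(1)] sized_star[OF assms(2)])

lemma sized_cst: "sized (cst n) \<and> star (cst n) = n"
  by (rule star_eqI) (auto simp: cst_def)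

lemma cst_star_sized: "sized U \<Longrightarrow> cst_star U = cst (star U)"
  by (auto simp: cst_star_def cst_def sized_star)

lemma sized_flam:
  assumes "sized Q"
  shows "sized (flam Q f) \<and> star (flam Q f) = star Q"
  by (rule star_eqI) (simp add: flam_def sized_star[OF assms])


section \<open>Arities and hereditarily monotone elements\<close>

datatype arity = Base | Arr arity arity

fun hmon :: "arity \<Rightarrow> elt \<Rightarrow> bool" and ord :: "bool \<Rightarrow> arity \<Rightarrow> elt \<Rightarrow> elt \<Rightarrow> bool" where
  "hmon Base U \<longleftrightarrow> sized U"
| "hmon (Arr a b) U \<longleftrightarrow> sized U \<and> (\<forall>X. hmon a X \<longrightarrow> hmon b (fapp U X)) \<and>
    (\<forall>X Y. hmon a X \<longrightarrow> hmon a Y \<longrightarrow> ord False a X Y \<longrightarrow> ord False b (fapp U X) (fapp U Y))"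
| "ord s Base U V \<longleftrightarrow> star V + of_bool s \<le> star U"
| "ord s (Arr a b) U V \<longleftrightarrow> star V + of_bool s \<le> star U \<and>
    (\<forall>X. hmon a X \<longrightarrow> ord s b (fapp U X) (fapp V X))"

lemma hmon_sized: "hmon a U \<Longrightarrow> sized U"
  by (cases a) auto

lemma ord_star: "ord s a U V \<Longrightarrow> star V + of_bool s \<le> star U"
  by (cases a) auto

lemma ord_refl: "ord False a U U"
  by (induction a arbitrary: U) auto

lemma ord_trans: "ord s a U V \<Longrightarrow> ord s' a V W \<Longrightarrow> ord (s \<or> s') a U W"
proof (induction a arbitrary: U V W)
  case Base
  then show ?case by auto
next
  case (Arr a b)
  have "star W + of_bool (s \<or> s') \<le> star U"
    using ord_star[OF Arr.prems(1)] ord_star[OF Arr.prems(2)] by auto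
  then show ?case using Arr by auto
qed

lemma ord_weaken: "ord s a U V \<Longrightarrow> ord False a U V"
  by (induction a arbitrary: U V) auto

lemma ord_eplus:
  "hmon a U \<Longrightarrow> hmon a U' \<Longrightarrow> hmon a V \<Longrightarrow> hmon a V' \<Longrightarrow> ord s a U U' \<Longrightarrow> ord s' a V V' \<Longrightarrow>
    ord (s \<or> s') a (U \<oplus> V) (U' \<oplus> V')"
proof (induction a arbitrary: U V U' V')
  case Base
  then show ?case by (auto simp: sized_eplus)
next
  case (Arr a b)
  then show ?case
    using hmon_sized[OF Arr.prems(1)] hmon_sized[OF Arr.prems(2)] hmon_sized[OF Arr.prems(3)]
      hmon_sized[OF Arr.prems(4)] ord_star[OF Arr.prems(5)] ord_star[OF Arr.prems(6)]
    by (auto simp: sized_eplus fapp_eplus)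
qed

lemma hmon_eplus: "hmon a U \<Longrightarrow> hmon a V \<Longrightarrow> hmon a (U \<oplus> V)"
proof (induction a arbitrary: U V)
  case Base
  then show ?case by (auto simp: sized_eplus)
next
  case (Arr a b)
  have *: "ord False b (fapp U X \<oplus> fapp V X) (fapp U Y \<oplus> fapp V Y)"
    if "hmon a X" "hmon a Y" "ord False a X Y" for X Y
    using ord_eplus[of b "fapp U X" "fapp U Y" "fapp V X" "fapp V Y" False False] Arr.prems that
    by auto
  have "hmon b (fapp U X \<oplus> fapp V X)" if "hmon a X" for X
    using Arr.prems that by (intro Arr.IH) auto
  then show ?case
    using * Arr.prems sized_eplus unfolding hmon.simps fapp_eplus by blast
qed

lemma hmon_cst: "hmon a (cst n)"
  by (induction a) (auto simp: sized_cst fapp_cst ord_refl)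

lemma ord_cst: "n + of_bool s \<le> m \<Longrightarrow> ord s a (cst m) (cst n)"
  by (induction a) (auto simp: sized_cst fapp_cst)

lemma ord_eplus_left: "hmon a U \<Longrightarrow> hmon a V \<Longrightarrow> ord False a (U \<oplus> V) U"
  by (induction a arbitrary: U V) (auto simp: sized_eplus fapp_eplus)

lemma ord_eplus_right: "hmon a U \<Longrightarrow> hmon a V \<Longrightarrow> ord False a (U \<oplus> V) V"
  by (induction a arbitrary: U V) (auto simp: sized_eplus fapp_eplus)

text \<open>Strictness of a padded comparison may come from the functional parts or from the
  constants; most comparisons below are brought to this form.\<close>

lemma ord_pad:
  assumes "hmon a U" "hmon a V" "ord s' a U V" "n \<le> m" "s \<Longrightarrow> s' \<or> n < m"
  shows "ord s a (U \<oplus> cst m) (V \<oplus> cst n)"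
proof -
  have "ord (n < m) a (cst m) (cst n)"
    using assms(4) by (intro ord_cst) auto
  from ord_eplus[OF assms(1,2) hmon_cst hmon_cst assms(3) this] show ?thesis
    using assms(5) ord_weaken by (cases s) auto
qed

lemma ord_add_cst: "hmon a U \<Longrightarrow> ord True a (U \<oplus> cst (Suc n)) U"
proof (induction a arbitrary: U)
  case Base
  then show ?case by (simp add: sized_eplus sized_cst)
next
  case (Arr a b)
  then show ?case by (simp add: sized_eplus sized_cst fapp_eplus fapp_cst)
qed


section \<open>Arities of terms\<close>

definition push :: "'a \<Rightarrow> (nat \<Rightarrow> 'a) \<Rightarrow> nat \<Rightarrow> 'a" where
  "push x \<rho> i = (case i of 0 \<Rightarrow> x | Suc j \<Rightarrow> \<rho> j)"

lemma push_simps [simp]: "push x \<rho> 0 = x" "push x \<rho> (Suc i) = \<rho> i"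
  by (simp_all add: push_def)

text \<open>A term and its type share an arity. Hence a variable gets the arity of its entry itself,
  whether declared or defined, and the two parts of a cast must agree.\<close>

primrec aty :: "(nat \<Rightarrow> arity option) \<Rightarrow> 's trm \<Rightarrow> arity option" where
  "aty \<Gamma> (Sort s) = Some Base"
| "aty \<Gamma> (Var i) = \<Gamma> i"
| "aty \<Gamma> (App V T) = (case aty \<Gamma> T of Some (Arr a b) \<Rightarrow> if aty \<Gamma> V = Some a then Some b else None
    | _ \<Rightarrow> None)"
| "aty \<Gamma> (Bind k V T) = (case aty \<Gamma> V of None \<Rightarrow> None | Some a \<Rightarrow>
    (case aty (push (Some a) \<Gamma>) T of None \<Rightarrow> None | Some b \<Rightarrow>
      Some (if k = Abst then Arr a b else b)))"
| "aty \<Gamma> (Cast U T) = (if aty \<Gamma> U = aty \<Gamma> T then aty \<Gamma> T else None)"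

lemma aty_App [simp]: "aty \<Gamma> (App V T) = Some b \<longleftrightarrow> (\<exists>a. aty \<Gamma> V = Some a \<and> aty \<Gamma> T = Some (Arr a b))"
  by (auto split: option.splits arity.splits)

lemma aty_Bind [simp]: "aty \<Gamma> (Bind k V T) = Some c \<longleftrightarrow>
    (\<exists>a b. aty \<Gamma> V = Some a \<and> aty (push (Some a) \<Gamma>) T = Some b \<and>
      c = (if k = Abst then Arr a b else b))"
  by (auto split: option.splits)

lemma aty_Cast [simp]: "aty \<Gamma> (Cast U T) = Some a \<longleftrightarrow> aty \<Gamma> U = Some a \<and> aty \<Gamma> T = Some a"
  by auto

declare aty.simps(3-5) [simp del]

primrec tyenv :: "'s env \<Rightarrow> nat \<Rightarrow> arity option" where
  "tyenv [] = (\<lambda>i. None)"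
| "tyenv (e # K) = push (aty (tyenv K) (snd e)) (tyenv K)"

text \<open>Insertion at position \<open>d\<close> is the counterpart of \<open>lift d\<close> on
  assignments; a general \<open>d\<close> is needed because lifting passes under binders.\<close>

definition ins :: "nat \<Rightarrow> 'a \<Rightarrow> (nat \<Rightarrow> 'a) \<Rightarrow> nat \<Rightarrow> 'a" where
  "ins d x \<rho> i = (if i < d then \<rho> i else if i = d then x else \<rho> (i - 1))"

lemma push_ins: "push y (ins d x \<rho>) = ins (Suc d) x (push y \<rho>)"
proof
  show "push y (ins d x \<rho>) i = ins (Suc d) x (push y \<rho>) i" for i
    by (cases i; cases "i - 1") (auto simp: ins_def)
qed

lemma ins_0: "ins 0 (\<rho> 0) (\<lambda>i. \<rho> (Suc i)) = \<rho>"
  by (rule ext) (auto simp: ins_def)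

lemma aty_ins_lift: "aty (ins d x \<Gamma>) (lift d T) = aty \<Gamma> T"
proof (induction T arbitrary: d \<Gamma>)
  case (Var i)
  then show ?case by (auto simp: ins_def)
qed (simp_all add: push_ins aty.simps(3-5) cong: option.case_cong arity.case_cong if_cong)

lemma aty_lift: "aty \<Gamma> (lift 0 T) = aty (\<lambda>i. \<Gamma> (Suc i)) T"
  using aty_ins_lift[of 0 "\<Gamma> 0" "\<lambda>i. \<Gamma> (Suc i)" T] by (simp add: ins_0)

lemma aty_ext_step: "ext_step L T1 T2 \<Longrightarrow> aty (tyenv L) T1 = Some a \<Longrightarrow> aty (tyenv L) T2 = Some a"
  by (induction arbitrary: a rule: ext_step.induct) (auto simp: aty_lift)

lemma aty_rt_step:
  "rt_step nxt L n T1 T2 \<Longrightarrow> aty (tyenv L) T1 = Some a \<Longrightarrow> aty (tyenv L) T2 = Some a"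
  by (induction arbitrary: a rule: rt_step.induct)
    (auto simp: aty_lift)

lemma aty_rt_steps:
  "rt_steps nxt L n T1 T2 \<Longrightarrow> aty (tyenv L) T1 = Some a \<Longrightarrow> aty (tyenv L) T2 = Some a"
  by (induction rule: rt_steps.induct) (auto dest: aty_rt_step)

text \<open>Reductions preserve arities, including the steps that pass from a term to a type. In an
  application the argument therefore has the arity of \<open>W0\<close>, and the function has that
  of the abstraction it reduces to; the two parts of a cast share the arity of
  \<open>U0\<close>.\<close>

lemma valid_aty: "valid nxt A L T \<Longrightarrow> \<exists>a. aty (tyenv L) T = Some a"
proof (induction rule: valid.induct)
  case (valid_cast L U T U0)
  then show ?case using aty_rt_steps by (metis aty_Cast option.sel)
next
  case (valid_app L V T n W0 U0)
  then obtain a c where ac: "aty (tyenv L) V = Some a" "aty (tyenv L) T = Some c" by blast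
  then have "aty (tyenv L) (Lam W0 U0) = Some c" "aty (tyenv L) W0 = Some a"
    using valid_app aty_rt_steps by blast+
  then obtain b where "c = Arr a b" by auto
  then show ?case using ac by auto
next
  case (valid_bind L V b T)
  then show ?case by (cases b) auto
qed auto


section \<open>Interpretation of terms\<close>

text \<open>A monotone functional may ignore its argument. Adding both stars makes the star of an
  application exceed those of its parts, and makes the value decrease strictly as soon as either
  part does.\<close>

definition sapp :: "elt \<Rightarrow> elt \<Rightarrow> elt" where
  "sapp v t = fapp t v \<oplus> (cst_star v \<oplus> (cst_star t \<oplus> cst 1))"

text \<open>
  The argument \<open>X\<close> of an abstraction reaches the body as \<open>v \<oplus> X \<oplus> cst 2\<close>: above the
  type \<open>v\<close>, because the variable may reduce to it, and above the value given to it by the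
  contractum of a \<open>\<beta>\<close>-redex, which is the cast of \<open>X\<close> to \<open>v\<close>.
\<close>

definition sbind :: "bkind \<Rightarrow> elt \<Rightarrow> (elt \<Rightarrow> elt) \<Rightarrow> elt" where
  "sbind k v f =
    (let Q = f (v \<oplus> cst 1) \<oplus> (cst_star v \<oplus> cst 1)
     in if k = Abst then flam Q (\<lambda>X. f (v \<oplus> X \<oplus> cst 2) \<oplus> (cst_star X \<oplus> (cst_star v \<oplus> cst 2)))
        else Q)"

primrec sem :: "'s trm \<Rightarrow> (nat \<Rightarrow> elt) \<Rightarrow> elt" where
  "sem (Sort s) \<rho> = cst 0"
| "sem (Var i) \<rho> = \<rho> i"
| "sem (App V T) \<rho> = sapp (sem V \<rho>) (sem T \<rho>)"
| "sem (Bind k V T) \<rho> = sbind k (sem V \<rho>) (\<lambda>X. sem T (push X \<rho>))"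
| "sem (Cast U T) \<rho> = sem U \<rho> \<oplus> sem T \<rho> \<oplus> cst 1"

text \<open>Stated for valuations that vary with \<open>X\<close>, so that the induction passes
  under binders, where the value of the bound variable also varies.\<close>

lemma cont_sem:
  assumes "\<And>i. cont (\<lambda>X. \<rho> X i)"
  shows "cont (\<lambda>X. sem T (\<rho> X))"
  using assms
proof (induction T arbitrary: \<rho>)
  case (Bind k V T)
  have *: "cont (\<lambda>X. sem T (push (f X) (\<rho> X)))" if "cont f" for f
  proof (rule Bind.IH(2))
    show "cont (\<lambda>X. push (f X) (\<rho> X) i)" for i
      using that Bind.prems by (cases i) auto
  qed
  have V: "cont (\<lambda>X. sem V (\<rho> X))" using Bind by blast
  show ?case
    by (cases "k = Abst")
      (auto simp: sbind_def Let_def intro!: cont_eplus cont_flam cont_const cont_id cont_cst_star * V)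
qed (auto simp: sapp_def intro!: cont_const cont_fapp cont_eplus cont_cst_star)

lemma cont_sem_push: "cont (\<lambda>X. sem T (push X \<rho>))"
proof (rule cont_sem)
  show "cont (\<lambda>X. push X \<rho> i)" for i
    by (cases i) (auto intro: cont_const cont_id)
qed

lemma cont_comp:
  assumes "cont f" "cont g"
  shows "cont (\<lambda>X. f (g X))"
proof (rule contI)
  show "t \<in> f (g Y)" if "X \<subseteq> Y" "t \<in> f (g X)" for X Y t
    using cont_mono[OF assms(1) _ that(2)] cont_mono[OF assms(2) that(1)] by blast
next
  fix X t assume "t \<in> f (g X)"
  then obtain F where F: "finite F" "F \<subseteq> g X" "t \<in> f F"
    using cont_fin[OF assms(1)] by metis
  then obtain G where "finite G" "G \<subseteq> X" "F \<subseteq> g G"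
    using cont_fin_subset[OF assms(2)] by metis
  then show "\<exists>G. finite G \<and> G \<subseteq> X \<and> t \<in> f (g G)"
    using cont_mono[OF assms(1) _ F(3)] by blast
qed

lemma sem_ins_lift: "sem (lift d T) (ins d x \<rho>) = sem T \<rho>"
proof (induction T arbitrary: d \<rho>)
  case (Var i)
  then show ?case by (auto simp: ins_def)
qed (simp_all add: push_ins)

lemma sem_lift: "sem (lift 0 T) \<rho> = sem T (\<lambda>i. \<rho> (Suc i))"
  using sem_ins_lift[of 0 T "\<rho> 0" "\<lambda>i. \<rho> (Suc i)"] by (simp add: ins_0)

lemma sapp_eq:
  assumes "hmon a v" "hmon (Arr a b) t"
  shows "sapp v t = fapp t v \<oplus> cst (star v + star t + 1)"
  using hmon_sized[OF assms(1)] hmon_sized[OF assms(2)]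
  by (simp add: sapp_def cst_star_sized cst_eplus_cst)

lemma hmon_sapp:
  assumes "hmon a v" "hmon (Arr a b) t"
  shows "hmon b (sapp v t)"
  unfolding sapp_eq[OF assms] using assms by (intro hmon_eplus hmon_cst) auto

lemma ord_sapp:
  assumes "hmon a v" "hmon a v'" "hmon (Arr a b) t" "hmon (Arr a b) t'"
    and "ord s a v v'" "ord s' (Arr a b) t t'"
  shows "ord (s \<or> s') b (sapp v t) (sapp v' t')"
proof -
  have "ord False b (fapp t v) (fapp t v')"
    using assms(1-3) ord_weaken[OF assms(5)] by simp
  moreover have "ord s' b (fapp t v') (fapp t' v')"
    using assms(2,6) by simp
  ultimately have "ord (False \<or> s') b (fapp t v) (fapp t' v')" by (rule ord_trans)
  then show ?thesis
    unfolding sapp_eq[OF assms(1,3)] sapp_eq[OF assms(2,4)]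
    using ord_star[OF assms(5)] ord_star[OF assms(6)] assms(1-4)
    by (intro ord_pad) auto
qed

lemma sbind_Abbr_eq: "sized v \<Longrightarrow> sbind Abbr v f = f (v \<oplus> cst 1) \<oplus> cst (star v + 1)"
  by (simp add: sbind_def cst_star_sized cst_eplus_cst)

lemma fapp_sbind_Abst:
  assumes "cont f" "sized v" "sized X"
  shows "fapp (sbind Abst v f) X = f (v \<oplus> X \<oplus> cst 2) \<oplus> cst (star X + star v + 2)"
proof -
  have "cont (\<lambda>X. f (v \<oplus> X \<oplus> cst 2) \<oplus> (cst_star X \<oplus> (cst_star v \<oplus> cst 2)))"
    by (intro cont_eplus cont_comp[OF assms(1)] cont_const cont_id cont_cst_star)
  from fapp_flam[OF this] show ?thesis
    using assms(2,3) by (simp add: sbind_def cst_star_sized cst_eplus_cst)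
qed

text \<open>\<open>Q\<close> determines the star for both kinds of binder. It evaluates the body at
  \<open>v \<oplus> cst 1\<close>, which is the value that \<open>val\<close> assigns to the entry
  when a subclosure step enters the body.\<close>

lemma sized_sbind:
  assumes "sized v" "sized (f (v \<oplus> cst 1))"
  shows "sized (sbind k v f) \<and> star (sbind k v f) = star (f (v \<oplus> cst 1)) + star v + 1"
  using assms by (simp add: sbind_def Let_def cst_star_sized cst_eplus_cst sized_eplus sized_flam sized_cst)

lemma hmon_sbind:
  assumes "cont f" "hmon a v" "\<And>X. hmon a X \<Longrightarrow> hmon b (f X)"
    and "\<And>X Y. hmon a X \<Longrightarrow> hmon a Y \<Longrightarrow> ord False a X Y \<Longrightarrow> ord False b (f X) (f Y)"
  shows "hmon (if k = Abst then Arr a b else b) (sbind k v f)"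
proof (cases k)
  case Abbr
  have "hmon b (f (v \<oplus> cst 1) \<oplus> cst (star v + 1))"
    by (intro assms(2,3) hmon_eplus hmon_cst)
  then show ?thesis
    using Abbr by (simp add: sbind_Abbr_eq hmon_sized[OF assms(2)])
next
  case Abst
  have v: "sized v" using assms(2) by (rule hmon_sized)
  have "hmon b (f (v \<oplus> cst 1))"
    by (intro assms(2,3) hmon_eplus hmon_cst)
  then have s: "sized (sbind Abst v f)"
    using sized_sbind[OF v] hmon_sized by blast
  have "hmon b (fapp (sbind Abst v f) X)" if "hmon a X" for X
    unfolding fapp_sbind_Abst[OF assms(1) v hmon_sized[OF that]]
    by (intro assms(2,3) that hmon_eplus hmon_cst)
  moreover have "ord False b (fapp (sbind Abst v f) X) (fapp (sbind Abst v f) Y)"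
    if XY: "hmon a X" "hmon a Y" "ord False a X Y" for X Y
  proof -
    have "ord (False \<or> False) a (v \<oplus> X) (v \<oplus> Y)"
      by (intro ord_eplus ord_refl assms(2) XY)
    then have "ord False a (v \<oplus> X \<oplus> cst 2) (v \<oplus> Y \<oplus> cst 2)"
      using ord_pad[of a "v \<oplus> X" "v \<oplus> Y" False 2 2 False] hmon_eplus[OF assms(2)] XY by simp
    then have "ord False b (f (v \<oplus> X \<oplus> cst 2)) (f (v \<oplus> Y \<oplus> cst 2))"
      by (intro assms(2,4) XY hmon_eplus hmon_cst)
    moreover have "hmon b (f (v \<oplus> X \<oplus> cst 2))" "hmon b (f (v \<oplus> Y \<oplus> cst 2))"
      by (intro assms(2,3) XY hmon_eplus hmon_cst)+
    ultimately show ?thesis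
      unfolding fapp_sbind_Abst[OF assms(1) v hmon_sized[OF XY(1)]]
        fapp_sbind_Abst[OF assms(1) v hmon_sized[OF XY(2)]]
      using ord_star[OF XY(3)] by (intro ord_pad[where s' = False]) simp_all
  qed
  ultimately show ?thesis using s Abst by simp
qed

text \<open>The bodies are compared only at arguments strictly above \<open>v'\<close>, since these
  are the only ones at which a binder evaluates them. A body that unfolds its variable decreases at
  exactly such arguments.\<close>

lemma ord_sbind:
  assumes f: "cont f" "cont f'" and v: "hmon a v" "hmon a v'" "ord s a v v'"
    and df: "\<And>X. hmon a X \<Longrightarrow> hmon b (f X)" "\<And>X. hmon a X \<Longrightarrow> hmon b (f' X)"
    and mono: "\<And>X Y. hmon a X \<Longrightarrow> hmon a Y \<Longrightarrow> ord False a X Y \<Longrightarrow> ord False b (f X) (f Y)"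
    and ff': "\<And>X. hmon a X \<Longrightarrow> ord True a X v' \<Longrightarrow> ord s' b (f X) (f' X)"
  shows "ord (s \<or> s') (if k = Abst then Arr a b else b) (sbind k v f) (sbind k v' f')"
proof -
  note sz = hmon_sized[OF v(1)] hmon_sized[OF v(2)]
  \<comment> \<open>Monotonicity of \<open>f\<close> moves the argument from \<open>X\<close> to
    \<open>Y\<close>; then \<open>f\<close> and \<open>f'\<close> are compared at \<open>Y\<close>,
    which is strictly above \<open>v'\<close>.\<close>
  have body: "ord s' b (f X) (f' Y)"
    if "hmon a X" "hmon a Y" "ord False a X Y" "ord True a Y v'" for X Y
    using ord_trans[OF mono[OF that(1-3)] ff'[OF that(2,4)]] by simp
  have ge1: "ord False a (v \<oplus> cst 1) (v' \<oplus> cst 1)"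
    using ord_pad[OF v(1,2) ord_weaken[OF v(3)], of 1 1 False] by simp
  have gt1: "ord True a (v' \<oplus> cst 1) v'"
    using ord_add_cst[OF v(2), of 0] by simp
  have v1: "ord s' b (f (v \<oplus> cst 1)) (f' (v' \<oplus> cst 1))"
    by (intro body ge1 gt1 hmon_eplus hmon_cst v(1,2))
  have d1: "hmon b (f (v \<oplus> cst 1))" "hmon b (f' (v' \<oplus> cst 1))"
    by (intro df v(1,2) hmon_eplus hmon_cst)+
  show ?thesis
  proof (cases k)
    case Abbr
    have "ord (s \<or> s') b (f (v \<oplus> cst 1) \<oplus> cst (star v + 1)) (f' (v' \<oplus> cst 1) \<oplus> cst (star v' + 1))"
      using ord_star[OF v(3)] by (intro ord_pad[OF d1 v1]) auto
    then show ?thesis using Abbr by (simp add: sbind_Abbr_eq sz)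
  next
    case Abst
    have "star (sbind Abst v' f') + of_bool (s \<or> s') \<le> star (sbind Abst v f)"
      using sized_sbind[of v f, OF sz(1) hmon_sized[OF d1(1)], of Abst]
        sized_sbind[of v' f', OF sz(2) hmon_sized[OF d1(2)], of Abst] ord_star[OF v1] ord_star[OF v(3)]
      by (cases s; cases s') simp_all
    moreover have "ord (s \<or> s') b (fapp (sbind Abst v f) X) (fapp (sbind Abst v' f') X)"
      if X: "hmon a X" for X
    proof -
      have "ord False a (v \<oplus> X) (v' \<oplus> X)"
        using ord_eplus[OF v(1,2) X X ord_weaken[OF v(3)] ord_refl] by simp
      then have w: "ord False a (v \<oplus> X \<oplus> cst 2) (v' \<oplus> X \<oplus> cst 2)"
        using ord_pad[OF hmon_eplus[OF v(1) X] hmon_eplus[OF v(2) X], of False 2 2 False] by simp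
      have "ord True a (v' \<oplus> X \<oplus> cst 2) (v' \<oplus> X)"
        using ord_add_cst[OF hmon_eplus[OF v(2) X], of 1] by (simp add: numeral_2_eq_2)
      then have w': "ord True a (v' \<oplus> X \<oplus> cst 2) v'"
        using ord_trans[OF _ ord_eplus_left[OF v(2) X], of True] by simp
      have "ord s' b (f (v \<oplus> X \<oplus> cst 2)) (f' (v' \<oplus> X \<oplus> cst 2))"
        by (intro body w w' hmon_eplus hmon_cst v(1,2) X)
      moreover have "hmon b (f (v \<oplus> X \<oplus> cst 2))" "hmon b (f' (v' \<oplus> X \<oplus> cst 2))"
        by (intro df v(1,2) X hmon_eplus hmon_cst)+
      ultimately show ?thesis
        unfolding fapp_sbind_Abst[OF f(1) sz(1) hmon_sized[OF X]]
          fapp_sbind_Abst[OF f(2) sz(2) hmon_sized[OF X]]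
        using ord_star[OF v(3)] by (intro ord_pad[where s' = s']) auto
    qed
    ultimately show ?thesis using Abst by simp
  qed
qed

section \<open>Monotonicity of the interpretation in the values of variables\<close>

definition denv :: "(nat \<Rightarrow> arity option) \<Rightarrow> (nat \<Rightarrow> elt) \<Rightarrow> bool" where
  "denv \<Gamma> \<rho> \<longleftrightarrow> (\<forall>i a. \<Gamma> i = Some a \<longrightarrow> hmon a (\<rho> i))"

lemma denv_push: "hmon a X \<Longrightarrow> denv \<Gamma> \<rho> \<Longrightarrow> denv (push (Some a) \<Gamma>) (push X \<rho>)"
  by (auto simp: denv_def push_def split: nat.splits)

text \<open>
  With \<open>s\<close> true, two environments of values that differ because entry \<open>p\<close> of \<open>L\<close> has
  been reduced: at least the entries depending on \<open>p\<close> have strictly decreased.  With \<open>s\<close> false,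
  the relation is weak decrease, and \<open>p\<close> and \<open>L\<close> are irrelevant.
\<close>

definition oenv :: "bool \<Rightarrow> nat \<Rightarrow> 's env \<Rightarrow> (nat \<Rightarrow> arity option) \<Rightarrow> (nat \<Rightarrow> elt) \<Rightarrow> (nat \<Rightarrow> elt) \<Rightarrow> bool"
  where "oenv s p L \<Gamma> \<rho> \<rho>' \<longleftrightarrow>
    (\<forall>i a. \<Gamma> i = Some a \<longrightarrow> ord (s \<and> p \<in> fvs L (Var i)) a (\<rho> i) (\<rho>' i))"

lemma oenv_push:
  assumes "ord (s \<and> p \<in> fvs L V) a X Y" "oenv s p L \<Gamma> \<rho> \<rho>'"
  shows "oenv s (Suc p) ((k, V) # L) (push (Some a) \<Gamma>) (push X \<rho>) (push Y \<rho>')"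
  unfolding oenv_def
proof (intro allI impI)
  fix i c assume "push (Some a) \<Gamma> i = Some c"
  then show "ord (s \<and> Suc p \<in> fvs ((k, V) # L) (Var i)) c (push X \<rho> i) (push Y \<rho>' i)"
    using assms unfolding oenv_def by (cases i) (auto simp: inj_image_mem_iff)
qed

text \<open>Both claims need one induction: the value of a binder is hereditarily monotone because
  its body is monotone in the bound variable. Strictness is governed by inherited free variables, so
  \<open>p\<close> may be reached through other entries.\<close>

lemma sem_hmon_ord:
  "aty \<Gamma> T = Some a \<Longrightarrow> denv \<Gamma> \<rho> \<Longrightarrow> hmon a (sem T \<rho>) \<and>
    (\<forall>s p (L :: 's env) \<rho>'. denv \<Gamma> \<rho>' \<longrightarrow> oenv s p L \<Gamma> \<rho> \<rho>' \<longrightarrow>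
      ord (s \<and> p \<in> fvs L T) a (sem T \<rho>) (sem (T :: 's trm) \<rho>'))"
proof (induction T arbitrary: \<Gamma> \<rho> a)
  case (Sort x)
  then show ?case by (simp add: hmon_cst ord_cst ord_refl)
next
  case (Var i)
  then show ?case by (simp add: denv_def oenv_def)
next
  case (App V T)
  then obtain b where ty: "aty \<Gamma> V = Some b" "aty \<Gamma> T = Some (Arr b a)" by auto
  note V = App.IH(1)[OF ty(1)] and T = App.IH(2)[OF ty(2)]
  show ?case
  proof (intro conjI allI impI)
    show "hmon a (sem (App V T) \<rho>)"
      using hmon_sapp V[OF App.prems(2)] T[OF App.prems(2)] by fastforce
  next
    fix s p and L :: "'s env" and \<rho>' assume *: "denv \<Gamma> \<rho>'" "oenv s p L \<Gamma> \<rho> \<rho>'"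
    have "ord ((s \<and> p \<in> fvs L V) \<or> (s \<and> p \<in> fvs L T)) a (sem (App V T) \<rho>) (sem (App V T) \<rho>')"
      unfolding sem.simps
      by (rule ord_sapp) (use V[OF App.prems(2)] T[OF App.prems(2)] V[OF *(1)] T[OF *(1)] * in blast)+
    then show "ord (s \<and> p \<in> fvs L (App V T)) a (sem (App V T) \<rho>) (sem (App V T) \<rho>')"
      by (simp add: conj_disj_distribL)
  qed
next
  case (Cast U T)
  then have ty: "aty \<Gamma> U = Some a" "aty \<Gamma> T = Some a" by auto
  note U = Cast.IH(1)[OF ty(1)] and T = Cast.IH(2)[OF ty(2)]
  show ?case
  proof (intro conjI allI impI)
    show "hmon a (sem (Cast U T) \<rho>)"
      using U[OF Cast.prems(2)] T[OF Cast.prems(2)] by (simp add: hmon_eplus hmon_cst)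
  next
    fix s p and L :: "'s env" and \<rho>' assume *: "denv \<Gamma> \<rho>'" "oenv s p L \<Gamma> \<rho> \<rho>'"
    have "ord ((s \<and> p \<in> fvs L U) \<or> (s \<and> p \<in> fvs L T)) a (sem U \<rho> \<oplus> sem T \<rho>) (sem U \<rho>' \<oplus> sem T \<rho>')"
      by (rule ord_eplus) (use U[OF Cast.prems(2)] T[OF Cast.prems(2)] U[OF *(1)] T[OF *(1)] * in blast)+
    moreover have "hmon a (sem U \<rho> \<oplus> sem T \<rho>)" "hmon a (sem U \<rho>' \<oplus> sem T \<rho>')"
      using U[OF Cast.prems(2)] T[OF Cast.prems(2)] U[OF *(1)] T[OF *(1)]
      by (blast intro: hmon_eplus)+
    ultimately have "ord ((s \<and> p \<in> fvs L U) \<or> (s \<and> p \<in> fvs L T)) a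
        (sem U \<rho> \<oplus> sem T \<rho> \<oplus> cst 1) (sem U \<rho>' \<oplus> sem T \<rho>' \<oplus> cst 1)"
      by (intro ord_pad[of a _ _ "(s \<and> p \<in> fvs L U) \<or> (s \<and> p \<in> fvs L T)"]) simp_all
    then show "ord (s \<and> p \<in> fvs L (Cast U T)) a (sem (Cast U T) \<rho>) (sem (Cast U T) \<rho>')"
      by (simp add: conj_disj_distribL)
  qed
next
  case (Bind k V T)
  then obtain b c where ty: "aty \<Gamma> V = Some b" "aty (push (Some b) \<Gamma>) T = Some c"
    and a: "a = (if k = Abst then Arr b c else c)" by auto
  note V = Bind.IH(1)[OF ty(1)] and T = Bind.IH(2)[OF ty(2) denv_push]
  have dT: "hmon c (sem T (push X \<rho>))" if "denv \<Gamma> \<rho>" "hmon b X" for X \<rho>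
    using T that by blast
  have mT: "ord False c (sem T (push X \<rho>)) (sem T (push Y \<rho>))"
    if "denv \<Gamma> \<rho>" "hmon b X" "hmon b Y" "ord False b X Y" for X Y \<rho>
  proof -
    have "oenv False (Suc 0) [(k, V)] (push (Some b) \<Gamma>) (push X \<rho>) (push Y \<rho>)"
      by (rule oenv_push) (use that in \<open>auto simp: oenv_def ord_refl\<close>)
    then show ?thesis
      using T[OF that(2,1)] denv_push[OF that(3,1)] by fastforce
  qed
  show ?case
  proof (intro conjI allI impI)
    show "hmon a (sem (Bind k V T) \<rho>)"
      unfolding sem.simps a using Bind.prems(2) V
      by (intro hmon_sbind cont_sem_push dT mT) auto
  next
    fix s p and L :: "'s env" and \<rho>' assume *: "denv \<Gamma> \<rho>'" "oenv s p L \<Gamma> \<rho> \<rho>'"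
    have V': "ord (s \<and> p \<in> fvs L V) b (sem V \<rho>) (sem V \<rho>')"
      using V[OF Bind.prems(2)] * by blast
    \<comment> \<open>If \<open>V\<close> depends on \<open>p\<close>, so does the bound variable,
      and a strict comparison of the bodies would ask its value to decrease, whereas
      \<open>X\<close> is the same on both sides. In that case the strictness comes from
      \<open>V\<close>, and the body is compared weakly.\<close>
    let ?s = "s \<and> p \<notin> fvs L V \<and> Suc p \<in> fvs ((k, V) # L) T"
    have T': "ord ?s c (sem T (push X \<rho>)) (sem T (push X \<rho>'))" if "hmon b X" for X
    proof -
      let ?q = "s \<and> p \<notin> fvs L V"
      have "oenv ?q p L \<Gamma> \<rho> \<rho>'"
        using *(2) ord_weaken unfolding oenv_def by (metis (full_types))
      then have "oenv ?q (Suc p) ((k, V) # L) (push (Some b) \<Gamma>) (push X \<rho>) (push X \<rho>')"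
        by (intro oenv_push) (auto simp: ord_refl)
      then have "ord (?q \<and> Suc p \<in> fvs ((k, V) # L) T) c (sem T (push X \<rho>)) (sem T (push X \<rho>'))"
        using T[OF that Bind.prems(2)] denv_push[OF that *(1)] by blast
      then show ?thesis by (simp add: conj_assoc)
    qed
    have "ord ((s \<and> p \<in> fvs L V) \<or> ?s) a (sem (Bind k V T) \<rho>) (sem (Bind k V T) \<rho>')"
      unfolding sem.simps a
      by (rule ord_sbind)
        (use V[OF Bind.prems(2)] V[OF *(1)] V' T' dT mT Bind.prems(2) *(1) in
          \<open>auto intro: cont_sem_push\<close>)
    moreover have "((s \<and> p \<in> fvs L V) \<or> ?s) = (s \<and> p \<in> fvs L (Bind k V T))" by auto
    ultimately show "ord (s \<and> p \<in> fvs L (Bind k V T)) a (sem (Bind k V T) \<rho>) (sem (Bind k V T) \<rho>')"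
      by simp
  qed
qed

lemma hmon_sem: "aty \<Gamma> T = Some a \<Longrightarrow> denv \<Gamma> \<rho> \<Longrightarrow> hmon a (sem T \<rho>)"
  using sem_hmon_ord by blast

lemma ord_sem:
  assumes "aty \<Gamma> T = Some a" "denv \<Gamma> \<rho>" "denv \<Gamma> \<rho>'"
    and "\<And>i a. \<Gamma> i = Some a \<Longrightarrow> ord (p \<in> fvs L (Var i)) a (\<rho> i) (\<rho>' i)"
  shows "ord (p \<in> fvs L T) a (sem T \<rho>) (sem T \<rho>')"
proof -
  have "oenv True p L \<Gamma> \<rho> \<rho>'" using assms(4) by (simp add: oenv_def)
  then have "ord (True \<and> p \<in> fvs L T) a (sem T \<rho>) (sem T \<rho>')"
    using sem_hmon_ord[OF assms(1,2)] assms(3) by blast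
  then show ?thesis by simp
qed

lemma ord_sem_push:
  fixes T :: "'s trm"
  assumes "aty (push (Some b) \<Gamma>) T = Some c" "denv \<Gamma> \<rho>" "hmon b X" "hmon b Y" "ord False b X Y"
  shows "ord False c (sem T (push X \<rho>)) (sem T (push Y \<rho>))"
proof -
  have "oenv False (Suc 0) [(Abst, T)] (push (Some b) \<Gamma>) (push X \<rho>) (push Y \<rho>)"
    by (rule oenv_push) (use assms in \<open>auto simp: oenv_def ord_refl\<close>)
  then show ?thesis
    using sem_hmon_ord[OF assms(1) denv_push[OF assms(3,2)]] denv_push[OF assms(4,2)] by fastforce
qed


section \<open>Steps decrease the interpretation\<close>

text \<open>
  Allows values above the canonical one of an entry, since the body of an abstraction is
  interpreted for all arguments.
\<close>

primrec compat :: "'s env \<Rightarrow> (nat \<Rightarrow> elt) \<Rightarrow> bool" where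
  "compat [] \<rho> \<longleftrightarrow> True"
| "compat (e # K) \<rho> \<longleftrightarrow>
    (\<forall>a. aty (tyenv K) (snd e) = Some a \<longrightarrow> ord True a (\<rho> 0) (sem (snd e) (\<lambda>i. \<rho> (Suc i)))) \<and>
    compat K (\<lambda>i. \<rho> (Suc i))"

lemma sirr_refl: "sirr T T"
  by (induction T) (auto intro: sirr.intros)

lemma ord_beta:
  assumes ty: "aty \<Gamma> V = Some a" "aty \<Gamma> W = Some a" "aty (push (Some a) \<Gamma>) T = Some b"
    and \<rho>: "denv \<Gamma> \<rho>"
  shows "ord True b (sem (App V (Lam W T)) \<rho>) (sem (Def (Cast W V) T) \<rho>)"
proof -
  have v: "hmon a (sem V \<rho>)" and w: "hmon a (sem W \<rho>)"
    using hmon_sem ty(1,2) \<rho> by blast+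
  have lam: "hmon (Arr a b) (sem (Lam W T) \<rho>)"
    using ty \<rho> by (intro hmon_sem) auto
  \<comment> \<open>The bound variable has this value on both sides: on the right it is the cast
    value \<open>sem W \<rho> \<oplus> sem V \<rho> \<oplus> cst 1\<close> with the
    \<open>cst 1\<close> of the definition added. Only the constants then differ.\<close>
  let ?X = "sem W \<rho> \<oplus> sem V \<rho> \<oplus> cst 2"
  have wv: "hmon a (sem W \<rho> \<oplus> sem V \<rho> \<oplus> cst 1)" "hmon a ?X"
    using v w by (auto intro!: hmon_eplus hmon_cst)
  have t: "hmon b (sem T (push ?X \<rho>))"
    by (intro hmon_sem[OF ty(3)] denv_push wv \<rho>)
  have "sem (App V (Lam W T)) \<rho> = fapp (sem (Lam W T) \<rho>) (sem V \<rho>) \<oplus>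
      cst (star (sem V \<rho>) + star (sem (Lam W T) \<rho>) + 1)"
    using sapp_eq[OF v lam] by simp
  also have "\<dots> = sem T (push ?X \<rho>) \<oplus> cst (star (sem V \<rho>) + star (sem W \<rho>) + 2 +
      (star (sem V \<rho>) + star (sem (Lam W T) \<rho>) + 1))"
    using fapp_sbind_Abst[OF cont_sem_push hmon_sized[OF w] hmon_sized[OF v], of T \<rho>]
    by (simp add: eplus_assoc cst_eplus_cst)
  finally have l: "sem (App V (Lam W T)) \<rho> = \<dots>" .
  have "star (sem W \<rho> \<oplus> sem V \<rho> \<oplus> cst 1) = star (sem W \<rho>) + star (sem V \<rho>) + 1"
    using hmon_sized[OF v] hmon_sized[OF w] by (simp add: sized_eplus sized_cst)
  then have r: "sem (Def (Cast W V) T) \<rho> =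
      sem T (push ?X \<rho>) \<oplus> cst (star (sem W \<rho>) + star (sem V \<rho>) + 1 + 1)"
    using sbind_Abbr_eq[OF hmon_sized[OF wv(1)], of "\<lambda>X. sem T (push X \<rho>)"]
    by (simp add: eplus_assoc cst_eplus_cst numeral_2_eq_2)
  show ?thesis
    unfolding l r by (intro ord_pad[OF t t ord_refl]) auto
qed

text \<open>The cost \<open>star (sem W \<rho>) + 1\<close> of the definition is counted twice on
  the left, in the result of the application and in the star of the function, but once on the
  right.\<close>

lemma ord_theta:
  assumes ty: "aty \<Gamma> V = Some a" "aty \<Gamma> W = Some c" "aty (push (Some c) \<Gamma>) T = Some (Arr a b)"
    and \<rho>: "denv \<Gamma> \<rho>"
  shows "ord True b (sem (App V (Def W T)) \<rho>) (sem (Def W (App (lift 0 V) T)) \<rho>)"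
proof -
  have v: "hmon a (sem V \<rho>)" and w: "hmon c (sem W \<rho>)"
    using hmon_sem ty(1,2) \<rho> by blast+
  let ?t = "sem T (push (sem W \<rho> \<oplus> cst 1) \<rho>)"
  have t: "hmon (Arr a b) ?t"
    by (intro hmon_sem[OF ty(3)] denv_push \<rho> hmon_eplus hmon_cst w)
  then have tv: "hmon b (fapp ?t (sem V \<rho>))" using v by simp
  have d: "sem (Def W T) \<rho> = ?t \<oplus> cst (star (sem W \<rho>) + 1)"
    using sbind_Abbr_eq[OF hmon_sized[OF w]] by simp
  have d_hmon: "hmon (Arr a b) (?t \<oplus> cst (star (sem W \<rho>) + 1))"
    by (intro hmon_eplus hmon_cst t)
  have star_d: "star (?t \<oplus> cst (star (sem W \<rho>) + 1)) = star ?t + star (sem W \<rho>) + 1"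
    using hmon_sized[OF t] by (simp add: sized_eplus sized_cst)
  have l: "sem (App V (Def W T)) \<rho> = fapp ?t (sem V \<rho>) \<oplus>
      cst (star (sem W \<rho>) + 1 + (star (sem V \<rho>) + (star ?t + star (sem W \<rho>) + 1) + 1))"
    unfolding sem.simps(3) d sapp_eq[OF v d_hmon] star_d fapp_eplus fapp_cst
    by (simp add: eplus_assoc cst_eplus_cst)
  have r: "sem (Def W (App (lift 0 V) T)) \<rho> = fapp ?t (sem V \<rho>) \<oplus>
      cst (star (sem V \<rho>) + star ?t + 1 + (star (sem W \<rho>) + 1))"
    using sbind_Abbr_eq[OF hmon_sized[OF w], of "\<lambda>X. sem (App (lift 0 V) T) (push X \<rho>)"]
      sapp_eq[OF v t]
    by (simp add: sem_lift eplus_assoc cst_eplus_cst)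
  show ?thesis
    unfolding l r by (intro ord_pad[OF tv tv ord_refl]) auto
qed

text \<open>All sorts have the same value, so replacing a sort is what the assumption on
  \<open>sirr\<close> excludes. The valuation ranges over all compatible ones because the body of a
  binder is compared at every argument strictly above the value of its entry.\<close>

lemma ord_ext_step:
  fixes T1 T2 :: "'s trm"
  shows "ext_step L T1 T2 \<Longrightarrow> aty (tyenv L) T1 = Some a \<Longrightarrow> denv (tyenv L) \<rho> \<Longrightarrow> compat L \<rho> \<Longrightarrow>
    \<not> sirr T1 T2 \<Longrightarrow> ord True a (sem T1 \<rho>) (sem T2 \<rho>)"
proof (induction arbitrary: a \<rho> rule: ext_step.induct)
  case (ext_beta L V W T)
  then show ?case using ord_beta[of "tyenv L"] by auto
next
  case (ext_theta L V W T)
  then show ?case using ord_theta[of "tyenv L"] by auto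
next
  case (ext_var0 b V K)
  then show ?case by (simp add: sem_lift)
next
  case (ext_zeta L V T)
  then obtain b where "aty (tyenv L) V = Some b" "aty (tyenv L) T = Some a"
    by (auto simp: aty_lift)
  then have "hmon b (sem V \<rho>)" "hmon a (sem T \<rho>)"
    using hmon_sem ext_zeta.prems(2) by blast+
  then show ?case
    using ord_add_cst[of a "sem T \<rho>" "star (sem V \<rho>)"]
    by (simp add: sbind_Abbr_eq hmon_sized sem_lift)
next
  case (ext_eps L U T)
  then have "hmon a (sem U \<rho>)" "hmon a (sem T \<rho>)"
    using hmon_sem by auto
  then show ?case
    using ord_trans[OF ord_add_cst[of a "sem U \<rho> \<oplus> sem T \<rho>" 0] ord_eplus_right]
    by (simp add: hmon_eplus)
next
  case (ext_ee L U T)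
  then have "hmon a (sem U \<rho>)" "hmon a (sem T \<rho>)"
    using hmon_sem by auto
  then show ?case
    using ord_trans[OF ord_add_cst[of a "sem U \<rho> \<oplus> sem T \<rho>" 0] ord_eplus_left]
    by (simp add: hmon_eplus)
next
  case (ext_sort L s1 s2)
  then show ?case by (simp add: sirr_sort)
next
  case (ext_lref K i T b V)
  \<comment> \<open>Otherwise \<open>lift 0 T\<close> would be \<open>Var (Suc i)\<close>, and the
    step a sort irrelevance.\<close>
  have "\<not> sirr (Var i) T"
  proof
    assume "sirr (Var i) T"
    then have "T = Var i" by cases auto
    then show False using ext_lref.prems(4) by (simp add: sirr_refl)
  qed
  then have "ord True a (sem (Var i :: 's trm) (\<lambda>i. \<rho> (Suc i))) (sem T (\<lambda>i. \<rho> (Suc i)))"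
    using ext_lref.prems by (intro ext_lref.IH) (auto simp: denv_def push_def split: nat.splits)
  then show ?case by (simp add: sem_lift)
next
  case (ext_app1 L V1 V2 T)
  then obtain b where ty: "aty (tyenv L) V1 = Some b" "aty (tyenv L) T = Some (Arr b a)" by auto
  have "ord True b (sem V1 \<rho>) (sem V2 \<rho>)"
    using ext_app1 ty(1) by (auto intro: sirr_app sirr_refl)
  from ord_sapp[OF _ _ _ _ this ord_refl] show ?case
    using hmon_sem ty aty_ext_step[OF ext_app1.hyps ty(1)] ext_app1.prems(2) by fastforce
next
  case (ext_app2 L T1 T2 V)
  then obtain b where ty: "aty (tyenv L) V = Some b" "aty (tyenv L) T1 = Some (Arr b a)" by auto
  have "ord True (Arr b a) (sem T1 \<rho>) (sem T2 \<rho>)"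
    using ext_app2.IH[OF ty(2)] ext_app2.prems sirr_app sirr_refl by blast
  from ord_sapp[OF _ _ _ _ ord_refl this] show ?case
    using hmon_sem ty aty_ext_step[OF ext_app2.hyps ty(2)] ext_app2.prems(2) by fastforce
next
  case (ext_cast1 L V1 V2 T)
  then have ty: "aty (tyenv L) V1 = Some a" "aty (tyenv L) T = Some a" by auto
  have "ord True a (sem V1 \<rho>) (sem V2 \<rho>)"
    using ext_cast1.IH[OF ty(1)] ext_cast1.prems sirr_cast sirr_refl by blast
  moreover have d: "hmon a (sem V1 \<rho>)" "hmon a (sem V2 \<rho>)" "hmon a (sem T \<rho>)"
    using hmon_sem ty aty_ext_step[OF ext_cast1.hyps ty(1)] ext_cast1.prems(2) by blast+
  ultimately have "ord True a (sem V1 \<rho> \<oplus> sem T \<rho>) (sem V2 \<rho> \<oplus> sem T \<rho>)"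
    using ord_eplus[OF d(1,2,3,3) _ ord_refl, of True] by simp
  then show ?case
    using d by (simp add: ord_pad[where s' = True] hmon_eplus)
next
  case (ext_cast2 L T1 T2 U)
  then have ty: "aty (tyenv L) T1 = Some a" "aty (tyenv L) U = Some a" by auto
  have "ord True a (sem T1 \<rho>) (sem T2 \<rho>)"
    using ext_cast2.IH[OF ty(1)] ext_cast2.prems sirr_cast sirr_refl by blast
  moreover have d: "hmon a (sem T1 \<rho>)" "hmon a (sem T2 \<rho>)" "hmon a (sem U \<rho>)"
    using hmon_sem ty aty_ext_step[OF ext_cast2.hyps ty(1)] ext_cast2.prems(2) by blast+
  ultimately have "ord True a (sem U \<rho> \<oplus> sem T1 \<rho>) (sem U \<rho> \<oplus> sem T2 \<rho>)"
    using ord_eplus[OF d(3,3,1,2) ord_refl, of True] by simp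
  then show ?case
    using d by (simp add: ord_pad[where s' = True] hmon_eplus)
next
  case (ext_bind1 L V1 V2 k T)
  then obtain b c where ty: "aty (tyenv L) V1 = Some b" "aty (push (Some b) (tyenv L)) T = Some c"
    and a: "a = (if k = Abst then Arr b c else c)" by auto
  have v: "hmon b (sem V1 \<rho>)" "hmon b (sem V2 \<rho>)"
    using hmon_sem ty(1) aty_ext_step[OF ext_bind1.hyps ty(1)] ext_bind1.prems(2) by blast+
  have lt: "ord True b (sem V1 \<rho>) (sem V2 \<rho>)"
    using ext_bind1.IH[OF ty(1)] ext_bind1.prems sirr_bind sirr_refl by blast
  have "ord (True \<or> False) a (sem (Bind k V1 T) \<rho>) (sem (Bind k V2 T) \<rho>)"
    unfolding sem.simps a
    by (rule ord_sbind[OF cont_sem_push cont_sem_push v lt])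
      (auto intro: ord_refl ord_sem_push[OF ty(2)] hmon_sem[OF ty(2)] denv_push ext_bind1.prems(2))
  then show ?case by simp
next
  case (ext_bind2 k V L T1 T2)
  then obtain b c where ty: "aty (tyenv L) V = Some b" "aty (push (Some b) (tyenv L)) T1 = Some c"
    and a: "a = (if k = Abst then Arr b c else c)" by auto
  have ty': "aty (push (Some b) (tyenv L)) T2 = Some c"
    using aty_ext_step[OF ext_bind2.hyps] ty by simp
  have v: "hmon b (sem V \<rho>)"
    using hmon_sem ty(1) ext_bind2.prems(2) by blast
  have "\<not> sirr T1 T2"
    using ext_bind2.prems(4) sirr_bind[OF sirr_refl] by blast
  then have T: "ord True c (sem T1 (push X \<rho>)) (sem T2 (push X \<rho>))"
    if "hmon b X" "ord True b X (sem V \<rho>)" for X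
    using ext_bind2.prems ty that
    by (intro ext_bind2.IH) (auto intro: denv_push)
  have "ord (False \<or> True) a (sem (Bind k V T1) \<rho>) (sem (Bind k V T2) \<rho>)"
    unfolding sem.simps a
    by (rule ord_sbind[OF cont_sem_push cont_sem_push v v ord_refl])
      (auto intro: T ord_sem_push[OF ty(2)] hmon_sem[OF ty(2)] hmon_sem[OF ty'] denv_push
        ext_bind2.prems(2))
  then show ?case by simp
qed

section \<open>Canonical valuations and environment steps\<close>

primrec val :: "'s env \<Rightarrow> nat \<Rightarrow> elt" where
  "val [] = (\<lambda>i. {})"
| "val (e # K) = push (sem (snd e) (val K) \<oplus> cst 1) (val K)"

text \<open>The default \<open>{}\<close> beyond the environment is harmless, as
  \<open>tyenv\<close> assigns no arity there.\<close>

lemma denv_val: "denv (tyenv L) (val L)"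
proof (induction L)
  case (Cons e K)
  then show ?case
    using Cons by (auto simp: denv_def push_def intro!: hmon_eplus hmon_cst hmon_sem split: nat.splits)
qed (simp add: denv_def)

text \<open>The summand \<open>cst 1\<close> in \<open>val\<close> provides the strict
  inequality.\<close>

lemma compat_val: "compat L (val L)"
proof (induction L)
  case (Cons e K)
  then show ?case
    by (auto intro: ord_add_cst hmon_sem denv_val)
qed simp

text \<open>The rules of \<open>env_rel\<close> build the index set along with the environments;
  this form starts from a given set and splits it at \<open>0\<close>.\<close>

lemma env_rel_Cons:
  assumes "env_rel R {i. Suc i \<in> f} K1 K2" "0 \<in> f \<Longrightarrow> R V1 V2"
  shows "env_rel R f ((b, V1) # K1) ((b, V2) # K2)"
proof (cases "0 \<in> f")
  case True
  have f: "f = insert 0 (Suc ` {i. Suc i \<in> f})"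
    using True by (auto simp: image_iff) (metis not0_implies_Suc)
  show ?thesis by (subst f) (rule env_rel_keep[OF assms(1) assms(2)[OF True]])
next
  case False
  have f: "f = Suc ` {i. Suc i \<in> f}"
    using False by (auto simp: image_iff) (metis not0_implies_Suc)
  show ?thesis by (subst f) (rule env_rel_skip[OF assms(1)])
qed

lemma finite_Suc_vimage: "finite f \<Longrightarrow> finite {i. Suc i \<in> f}"
  using finite_vimageI[of f Suc] by (simp add: vimage_def)

lemma env_rel_refl: "finite f \<Longrightarrow> (\<And>V. R V V) \<Longrightarrow> env_rel R f L L"
proof (induction L arbitrary: f)
  case (Cons e K)
  then show ?case
    using env_rel_Cons[of R f K K "snd e" "snd e" "fst e"] by (simp add: finite_Suc_vimage)
qed (simp add: env_rel_nil)

lemma env_rel_mono: "env_rel R f L1 L2 \<Longrightarrow> (\<And>V W. R V W \<Longrightarrow> R' V W) \<Longrightarrow> env_rel R' f L1 L2"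
  by (induction rule: env_rel.induct) (auto intro: env_rel.intros)

lemma map_leD: "\<Gamma> \<subseteq>\<^sub>m \<Gamma>' \<Longrightarrow> \<Gamma> i = Some a \<Longrightarrow> \<Gamma>' i = Some a"
  unfolding map_le_def by (drule bspec[of _ _ i]) (rule domI, assumption, erule subst)

lemma push_map_le:
  assumes "x = None \<or> x = y" "\<Gamma> \<subseteq>\<^sub>m \<Gamma>'"
  shows "push x \<Gamma> \<subseteq>\<^sub>m push y \<Gamma>'"
  unfolding map_le_def
proof
  fix i assume "i \<in> dom (push x \<Gamma>)"
  then obtain a where a: "push x \<Gamma> i = Some a" by (rule domD[THEN exE])
  show "push x \<Gamma> i = push y \<Gamma>' i"
  proof (cases i)
    case 0
    then show ?thesis using a assms(1) by auto
  next
    case (Suc j)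
    with a have "\<Gamma> j = Some a" by simp
    then show ?thesis using map_leD[OF assms(2)] Suc a by simp
  qed
qed

lemma aty_mono: "aty \<Gamma> T = Some a \<Longrightarrow> \<Gamma> \<subseteq>\<^sub>m \<Gamma>' \<Longrightarrow> aty \<Gamma>' T = Some a"
proof (induction T arbitrary: \<Gamma> \<Gamma>' a)
  case (Bind k V T)
  from Bind.prems(1) obtain b c where ty: "aty \<Gamma> V = Some b" "aty (push (Some b) \<Gamma>) T = Some c"
    and a: "a = (if k = Abst then Arr b c else c)" by auto
  have "aty \<Gamma>' V = Some b" "aty (push (Some b) \<Gamma>') T = Some c"
    by (rule Bind.IH(1)[OF ty(1) Bind.prems(2)])
      (rule Bind.IH(2)[OF ty(2) push_map_le[OF disjI2[OF refl] Bind.prems(2)]])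
  then show ?case using a by auto
next
  case (App V T)
  from App.prems(1) obtain b where ty: "aty \<Gamma> V = Some b" "aty \<Gamma> T = Some (Arr b a)" by auto
  have "aty \<Gamma>' V = Some b" "aty \<Gamma>' T = Some (Arr b a)"
    by (rule App.IH(1)[OF ty(1) App.prems(2)]) (rule App.IH(2)[OF ty(2) App.prems(2)])
  then show ?case by simp
next
  case (Cast U T)
  from Cast.prems(1) have ty: "aty \<Gamma> U = Some a" "aty \<Gamma> T = Some a" by auto
  show ?case
    using Cast.IH(1)[OF ty(1) Cast.prems(2)] Cast.IH(2)[OF ty(2) Cast.prems(2)] by simp
next
  case (Var i)
  from map_leD[OF Var.prems(2), of i a] Var.prems(1) show ?case by simp
qed simp

text \<open>Only an inclusion: entries on which the term does not depend may lack an arity, and a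
  step can give them one, for instance by resolving a cast whose parts disagree.\<close>

lemma tyenv_ext_env_step: "ext_env_step L1 L2 \<Longrightarrow> tyenv L1 \<subseteq>\<^sub>m tyenv L2"
proof (induction rule: ext_env_step.induct)
  case (ext_env_tail K1 K2 b V)
  have "aty (tyenv K1) V = None \<or> aty (tyenv K1) V = aty (tyenv K2) V"
  proof (cases "aty (tyenv K1) V")
    case (Some a)
    from aty_mono[OF this ext_env_tail.IH] show ?thesis by (simp add: Some)
  qed simp
  then show ?case by (simp add: push_map_le ext_env_tail.IH)
next
  case (ext_env_head K V1 V2 b)
  have "aty (tyenv K) V1 = None \<or> aty (tyenv K) V1 = aty (tyenv K) V2"
  proof (cases "aty (tyenv K) V1")
    case (Some a)
    from aty_ext_step[OF ext_env_head this] show ?thesis by (simp add: Some)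
  qed simp
  then show ?case by (simp add: push_map_le)
qed

lemma denv_map_le: "denv \<Gamma>' \<rho> \<Longrightarrow> \<Gamma> \<subseteq>\<^sub>m \<Gamma>' \<Longrightarrow> denv \<Gamma> \<rho>"
  unfolding denv_def by (blast dest: map_leD)

text \<open>Here \<open>p\<close> is the position of the reduced entry. For closures that are not
  related, the first conjunct forces \<open>p\<close> into the inherited free variables of the term;
  the second is then the hypothesis of \<open>ord_sem\<close>.\<close>

lemma ext_env_step_entry:
  assumes "ext_env_step L1 L2"
  shows "(\<forall>f. finite f \<longrightarrow> env_rel sirr f L1 L2) \<or>
    (\<exists>p. (\<forall>f. finite f \<longrightarrow> p \<notin> f \<longrightarrow> env_rel sirr f L1 L2) \<and>
      (\<forall>i a. tyenv L1 i = Some a \<longrightarrow> ord (p \<in> fvs L1 (Var i)) a (val L1 i) (val L2 i)))"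
  using assms
proof induction
  case (ext_env_tail K1 K2 b V)
  have K2: "denv (tyenv K1) (val K2)"
    using denv_map_le[OF denv_val tyenv_ext_env_step[OF ext_env_tail.hyps]] .
  from ext_env_tail.IH show ?case
  proof (elim disjE exE conjE)
    assume "\<forall>f. finite f \<longrightarrow> env_rel sirr f K1 K2"
    then show ?thesis
      by (intro disjI1 allI impI env_rel_Cons) (auto simp: sirr_refl finite_Suc_vimage)
  next
    fix p assume p: "\<forall>f. finite f \<longrightarrow> p \<notin> f \<longrightarrow> env_rel sirr f K1 K2"
      and ord: "\<forall>i a. tyenv K1 i = Some a \<longrightarrow> ord (p \<in> fvs K1 (Var i)) a (val K1 i) (val K2 i)"
    have "env_rel sirr f ((b, V) # K1) ((b, V) # K2)" if "finite f" "Suc p \<notin> f" for f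
      using p that by (intro env_rel_Cons) (auto simp: sirr_refl finite_Suc_vimage)
    moreover have "ord (Suc p \<in> fvs ((b, V) # K1) (Var i)) a (val ((b, V) # K1) i) (val ((b, V) # K2) i)"
      if i: "tyenv ((b, V) # K1) i = Some a" for i a
    proof (cases i)
      case 0
      then have ty: "aty (tyenv K1) V = Some a" using i by simp
      \<comment> \<open>An unchanged entry still loses value if it depends on \<open>p\<close>,
        which is exactly when \<open>fvs\<close> puts \<open>Suc p\<close> among the variables of
        \<open>Var 0\<close>.\<close>
      have "ord (p \<in> fvs K1 V) a (sem V (val K1)) (sem V (val K2))"
        using ord by (intro ord_sem[OF ty denv_val K2]) blast
      then show ?thesis
        using 0 hmon_sem[OF ty denv_val] hmon_sem[OF ty K2]
        by (simp add: inj_image_mem_iff ord_pad)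
    next
      case (Suc j)
      then show ?thesis using i ord by (simp add: inj_image_mem_iff)
    qed
    ultimately show ?thesis by blast
  qed
next
  case (ext_env_head K V1 V2 b)
  show ?case
  proof (cases "sirr V1 V2")
    case True
    then show ?thesis
      by (intro disjI1 allI impI env_rel_Cons env_rel_refl) (auto simp: sirr_refl finite_Suc_vimage)
  next
    case False
    have "env_rel sirr f ((b, V1) # K) ((b, V2) # K)" if "finite f" "0 \<notin> f" for f
      using that by (intro env_rel_Cons env_rel_refl) (auto simp: sirr_refl finite_Suc_vimage)
    moreover have "ord (0 \<in> fvs ((b, V1) # K) (Var i)) a (val ((b, V1) # K) i) (val ((b, V2) # K) i)"
      if i: "tyenv ((b, V1) # K) i = Some a" for i a
    proof (cases i)
      case 0
      then have ty: "aty (tyenv K) V1 = Some a" using i by simp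
      have "ord True a (sem V1 (val K)) (sem V2 (val K))"
        by (rule ord_ext_step[OF ext_env_head.hyps ty denv_val compat_val False])
      then have "ord True a (sem V1 (val K) \<oplus> cst 1) (sem V2 (val K) \<oplus> cst 1)"
        using hmon_sem[OF ty denv_val] hmon_sem[OF aty_ext_step[OF ext_env_head.hyps ty] denv_val]
        by (intro ord_pad) auto
      then show ?thesis using 0 by simp
    next
      case (Suc j)
      then show ?thesis by (simp add: image_iff ord_refl)
    qed
    ultimately show ?thesis by blast
  qed
qed

section \<open>The decreasing measure and strong normalization\<close>

lemma aty_dsub:
  "dsub (L1, T1) (L2, T2) \<Longrightarrow> aty (tyenv L1) T1 = Some a \<Longrightarrow> \<exists>b. aty (tyenv L2) T2 = Some b"
  by (erule dsub.cases) (auto simp: aty_lift)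

text \<open>Entries and compound terms add at least 1 to the stars of their parts. Dropping an entry
  keeps the value by \<open>sem_lift\<close>, hence the length as second component.\<close>

lemma star_dsub:
  assumes "dsub (L1, T1) (L2, T2)" "aty (tyenv L1) T1 = Some a"
  shows "star (sem T2 (val L2)) < star (sem T1 (val L1)) \<or>
    star (sem T2 (val L2)) = star (sem T1 (val L1)) \<and> length L2 < length L1"
proof -
  have sz: "sized (sem T (val L))" if "aty (tyenv L) T = Some c" for L :: "'a env" and T :: "'a trm" and c
    using hmon_sized[OF hmon_sem[OF that denv_val]] .
  from assms(1) show ?thesis
  proof cases
    case (dsub_var0 b)
    then have "sized (sem T2 (val L2))" using assms(2) by (intro sz) auto
    then show ?thesis using dsub_var0 by (simp add: sized_eplus sized_cst)
  next
    case (dsub_drop b V)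
    then show ?thesis by (simp add: sem_lift)
  next
    case (dsub_app1 T)
    then obtain b where ty: "aty (tyenv L1) T2 = Some b" "aty (tyenv L1) T = Some (Arr b a)"
      using assms(2) by auto
    note d = hmon_sem[OF ty(1) denv_val] hmon_sem[OF ty(2) denv_val]
    have "hmon a (fapp (sem T (val L1)) (sem T2 (val L1)))" using d by simp
    then have "sized (fapp (sem T (val L1)) (sem T2 (val L1)))" by (rule hmon_sized)
    then show ?thesis using dsub_app1 by (simp add: sapp_eq[OF d] sized_eplus sized_cst)
  next
    case (dsub_app2 V)
    then obtain b where ty: "aty (tyenv L1) V = Some b" "aty (tyenv L1) T2 = Some (Arr b a)"
      using assms(2) by auto
    note d = hmon_sem[OF ty(1) denv_val] hmon_sem[OF ty(2) denv_val]
    have "hmon a (fapp (sem T2 (val L1)) (sem V (val L1)))" using d by simp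
    then have "sized (fapp (sem T2 (val L1)) (sem V (val L1)))" by (rule hmon_sized)
    then show ?thesis using dsub_app2 by (simp add: sapp_eq[OF d] sized_eplus sized_cst)
  next
    case (dsub_cast1 T)
    then have "sized (sem T2 (val L1))" "sized (sem T (val L1))" using assms(2) by (auto intro: sz)
    then show ?thesis using dsub_cast1 by (simp add: sized_eplus sized_cst)
  next
    case (dsub_cast2 V)
    then have "sized (sem T2 (val L1))" "sized (sem V (val L1))" using assms(2) by (auto intro: sz)
    then show ?thesis using dsub_cast2 by (simp add: sized_eplus sized_cst)
  next
    case (dsub_bind1 b T)
    then obtain c where "aty (tyenv L1) T2 = Some c" "\<exists>d. aty (tyenv ((b, T2) # L1)) T = Some d"
      using assms(2) by auto
    then have "sized (sem T2 (val L1))" "sized (sem T (push (sem T2 (val L1) \<oplus> cst 1) (val L1)))"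
      using sz[of L1 T2] sz[of "(b, T2) # L1" T] by auto
    from sized_sbind[of _ "\<lambda>X. sem T (push X (val L1))", OF this] show ?thesis
      using dsub_bind1 by simp
  next
    case (dsub_bind2 b V)
    then obtain c where "aty (tyenv L1) V = Some c" "\<exists>d. aty (tyenv ((b, V) # L1)) T2 = Some d"
      using assms(2) by auto
    then have "sized (sem V (val L1))" "sized (sem T2 (push (sem V (val L1) \<oplus> cst 1) (val L1)))"
      using sz[of L1 V] sz[of "(b, V) # L1" T2] by auto
    from sized_sbind[of _ "\<lambda>X. sem T2 (push X (val L1))", OF this] show ?thesis
      using dsub_bind2 by simp
  qed
qed

lemma qrst_step_decreases:
  assumes "qrst_step (L1, T1) (L2, T2)" "\<not> sirr_closure (L1, T1) (L2, T2)"
    and ty: "aty (tyenv L1) T1 = Some a"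
  shows "(star (sem T2 (val L2)) < star (sem T1 (val L1)) \<or>
      star (sem T2 (val L2)) = star (sem T1 (val L1)) \<and> length L2 < length L1) \<and>
    (\<exists>b. aty (tyenv L2) T2 = Some b)"
  using assms(1)
proof cases
  case qrst_term
  have "\<not> sirr T1 T2"
    using assms(2) qrst_term(1) env_rel_refl[of _ sirr, OF finite_fvs sirr_refl] by auto
  from ord_star[OF ord_ext_step[OF qrst_term(2) ty denv_val compat_val this]]
  show ?thesis using aty_ext_step[OF qrst_term(2) ty] qrst_term(1) by auto
next
  case qrst_env
  have nr: "\<not> env_rel sirr (fvs L1 T1) L1 L2"
    using assms(2) qrst_env(1) sirr_refl by auto
  then obtain p where p: "p \<in> fvs L1 T1"
    and ord: "\<And>i a. tyenv L1 i = Some a \<Longrightarrow> ord (p \<in> fvs L1 (Var i)) a (val L1 i) (val L2 i)"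
    using ext_env_step_entry[OF qrst_env(2)] finite_fvs by metis
  have "denv (tyenv L1) (val L2)"
    using denv_map_le[OF denv_val tyenv_ext_env_step[OF qrst_env(2)]] .
  from ord_star[OF ord_sem[OF ty denv_val this ord]] p
  show ?thesis
    using aty_mono[OF ty tyenv_ext_env_step[OF qrst_env(2)]] qrst_env(1) by auto
next
  case qrst_eq
  \<comment> \<open>Equality on the inherited free variables implies sort irrelevance, so these
    steps are never counted.\<close>
  have "sirr_closure (L1, T1) (L2, T2)"
    using env_rel_mono[of "(=)" _ L1 L2 sirr] qrst_eq by (simp add: env_eq_def sirr_refl)
  then show ?thesis using assms(2) by blast
next
  case qrst_sub
  then show ?thesis using star_dsub[OF _ ty] aty_dsub[OF _ ty] by blast
qed

text \<open>Having an arity is the invariant; star and length form the lexicographic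
  measure.\<close>

lemma aty_SN:
  "\<exists>a. aty (tyenv (fst C)) (snd C) = Some a \<Longrightarrow> SN C"
proof (induction C rule: wf_induct_rule[OF wf_measures[of
      "[\<lambda>C. star (sem (snd C) (val (fst C))), \<lambda>C. length (fst C)]"]])
  case (1 C)
  show ?case
  proof (rule SN_intro)
    fix C2 assume *: "qrst_step C C2" "\<not> sirr_closure C C2"
    obtain L1 T1 L2 T2 where C: "C = (L1, T1)" "C2 = (L2, T2)"
      by (cases C, cases C2)
    from 1(2) C obtain a where ty: "aty (tyenv L1) T1 = Some a" by auto
    note dec = qrst_step_decreases[OF *[unfolded C] ty]
    show "SN C2"
      by (rule 1(1)) (use dec C in auto)
  qed
qed

theorem theorem4p4:
  fixes nxt :: "'s \<Rightarrow> 's" and A :: "nat set" and L :: "'s env" and T :: "'s trm"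
  assumes "valid nxt A L T"
  shows "SN (L, T)"
  using aty_SN[of "(L, T)"] valid_aty[OF assms] by simp

end
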